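(* Let $n\ge 1$ and let $D=(D_1,\ldots,D_n)$ be a diagram, i.e. each $D_j\subseteq[n]$. The following conditions are equivalent: (1) The Schubitope $\mathcal{S}_D$ is lattice-free; (2) for all $1\le i<j\le n$, $|M(D_i)\cap M(D_j)|\le 1$; (3) for all integers $t\ge 0$, $$ i(\mathcal{S}_D,t)=\prod_{j=1}^n i\big(P(SM_n(D_j)),t\big).$$
   Context: A diagram $D$ is a set of boxes in the $n\times n$ grid, box $(i,j)$ being in row $i$ (from the top) and column $j$; it is recorded as $D=(D_1,\ldots,D_n)$ with $D_j=\{i:(i,j)\in D\}\subseteq[n]$, and $\#D=\sum_j|D_j|$. For $a\le b$ write $[a,b]=\{a,a+1,\ldots,b\}$. The movable interval $M(D_j)$ of column $D_j$ is defined as follows: if $D_j\ne[n]$, let $a=\min([n]\setminus D_j)$ (topmost row without a box) and $b=\max D_j$ (bottommost row with a box, if $D_j\neq\emptyset$); then $M(D_j)=[a,b]$ if $D_j\neq\emptyset$ and $a<b$, and $M(D_j)=\emptyset$ otherwise. Schubitope: for $I\subseteq[n]$ and column $j$, form the word $\mathrm{word}_I(D_j)$ by reading rows $i=1,\ldots,n$ top to bottom and recording "(" if $i\notin D_j, i\in I$; ")" if $i\in D_j, i\notin I$; "$\star$" if $i\in D_j, i\in I$ (nothing otherwise). Let $\theta_{D_j}(I)$ be the number of matched pairs of parentheses in this word plus the number of $\star$'s, and $\theta_D(I)=\sum_{j=1}^n\theta_{D_j}(I)$. Then $\mathcal{S}_D=\{\alpha\in\mathbb{R}_{\ge0}^n:\sum_i\alpha_i=\#D,\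 \sum_{i\in I}\alpha_i\le\theta_D(I)\ \forall I\subseteq[n]\}$. (It is known, by Fink–Mészáros–St. Dizier, that $\mathcal{S}_D=P(SM_n(D_1))+\cdots+P(SM_n(D_n))$, Minkowski sum.) Schubert matroid: for $S\subseteq[n]$, $SM_n(S)$ is the matroid on $[n]$ whose bases are the $T\subseteq[n]$ with $T\preceq S$ in Gale order: $|T|=|S|$ and, writing $T=\{a_1<\cdots<a_k\}$, $S=\{b_1<\cdots<b_k\}$, $a_i\le b_i$ for all $i$. Its matroid (base) polytope is $P(SM_n(S))=\mathrm{conv}\{\mathbf e_B: B \text{ a basis}\}$, where $\mathbf e_B=\sum_{b\in B}\mathbf e_b$ is the indicator vector. A polytope $P\subset\mathbb{R}^n$ is lattice-free if $P\cap\mathbb{Z}^n$ equals its vertex set. For a polytope $P$, $i(P,t)=|tP\cap\mathbb{Z}^n|$ (its Ehrhart polynomial when $P$ is integral); by convention the Ehrhart polynomial of the empty set is $1$. *)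

theory Defs
  imports "HOL-Analysis.Analysis"
begin

text \<open>
  The index set \<open>[n]\<close>, \<open>n \<ge> 1\<close>, is a type \<open>'n\<close> that is finite and linearly ordered, hence
  order-isomorphic to \<open>{1..n}\<close> with \<open>n = CARD('n)\<close>; smaller rows are higher up. A diagram is
  given by its columns: \<open>D j\<close> is the set of rows of the boxes in column \<open>j\<close>.
\<close>

type_synonym 'n diagram = "'n \<Rightarrow> 'n set"

definition num_boxes :: "'n::finite diagram \<Rightarrow> nat" where
  "num_boxes D = (\<Sum>j\<in>UNIV. card (D j))"

definition movable_interval :: "'n::{finite,linorder} set \<Rightarrow> 'n set" where
  "movable_interval C =
    (if C \<noteq> UNIV \<and> C \<noteq> {} \<and> Min (UNIV - C) < Max C then {Min (UNIV - C)..Max C} else {})"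

datatype symbol = LParen | RParen | Star

definition column_word :: "'n::{finite,linorder} set \<Rightarrow> 'n set \<Rightarrow> symbol list" where
  "column_word I C = concat (map
     (\<lambda>i. if i \<notin> C \<and> i \<in> I then [LParen]
          else if i \<in> C \<and> i \<notin> I then [RParen]
          else if i \<in> C \<and> i \<in> I then [Star]
          else [])
     (sorted_list_of_set UNIV))"

text \<open>
  \<open>matched_pairs k w\<close> is the number of pairs closed while reading \<open>w\<close> from left to right, when \<open>k\<close>
  left parentheses are still open at the start.
\<close>

fun matched_pairs :: "nat \<Rightarrow> symbol list \<Rightarrow> nat" where
  "matched_pairs k [] = 0"
| "matched_pairs k (LParen # w) = matched_pairs (Suc k) w"
| "matched_pairs 0 (RParen # w) = matched_pairs 0 w"
| "matched_pairs (Suc k) (RParen # w) = Suc (matched_pairs k w)"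
| "matched_pairs k (Star # w) = matched_pairs k w"

definition theta_column :: "'n::{finite,linorder} set \<Rightarrow> 'n set \<Rightarrow> nat" where
  "theta_column C I = matched_pairs 0 (column_word I C) + count_list (column_word I C) Star"

definition theta :: "'n::{finite,linorder} diagram \<Rightarrow> 'n set \<Rightarrow> nat" where
  "theta D I = (\<Sum>j\<in>UNIV. theta_column (D j) I)"

definition schubitope :: "'n::{finite,linorder} diagram \<Rightarrow> (real ^ 'n::{finite,linorder}) set" where
  "schubitope D = {\<alpha>. (\<forall>i. 0 \<le> \<alpha> $ i) \<and> (\<Sum>i\<in>UNIV. \<alpha> $ i) = real (num_boxes D) \<and>
     (\<forall>I. (\<Sum>i\<in>I. \<alpha> $ i) \<le> real (theta D I))}"

definition gale_le :: "'n::{finite,linorder} set \<Rightarrow> 'n set \<Rightarrow> bool" where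
  "gale_le T S \<longleftrightarrow> card T = card S \<and>
     (\<forall>i<card S. sorted_list_of_set T ! i \<le> sorted_list_of_set S ! i)"

definition schubert_matroid_bases :: "'n::{finite,linorder} set \<Rightarrow> 'n set set" where
  "schubert_matroid_bases S = {T. gale_le T S}"

text \<open>The base polytope of a matroid on \<open>'n\<close>, as a function of its set of bases.\<close>

definition base_polytope :: "'n::finite set set \<Rightarrow> (real ^ 'n::finite) set" where
  "base_polytope \<B> = convex hull ((\<lambda>B. \<Sum>b\<in>B. axis b 1) ` \<B>)"

definition lattice_points :: "(real ^ 'n::finite) set" where
  "lattice_points = {x. \<forall>i. x $ i \<in> \<int>}"

definition lattice_free :: "(real ^ 'n::finite) set \<Rightarrow> bool" where
  "lattice_free P \<longleftrightarrow> P \<inter> lattice_points = {x. x extreme_point_of P}"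

text \<open>By convention the empty set has count \<open>1\<close>.\<close>

definition ehrhart :: "(real ^ 'n::finite) set \<Rightarrow> nat \<Rightarrow> nat" where
  "ehrhart P t = (if P = {} then 1 else card (((*\<^sub>R) (real t) ` P) \<inter> lattice_points))"

end

theory Submission imports Defs begin

text \<open>
  The number \<open>theta_column C I\<close> is the minimum of \<open>|C \<inter> U| + |I - U|\<close> over the up-sets \<open>U\<close> of rows, which
  makes it submodular in \<open>I\<close> and identifies it with the rank function of the Schubert matroid of \<open>C\<close>.
  By a sandwich theorem for submodular functions, valid over the reals and over the integers alike, every point
  (lattice point) of the Schubitope and of its dilates is a sum of points (lattice points) of the
  dilated Schubert matroid polytopes. Hence both lattice-freeness and the product formula amount to the
  uniqueness of such decompositions.

  All points of the polytope of \<open>C\<close> agree outside the movable interval of \<open>C\<close>. If the movable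
  intervals meet pairwise in at most one row, then, after deletion of their last rows, they are disjoint, and
  partial sums over the rows show that decompositions are unique. If two movable intervals share
  rows \<open>p < q\<close>, then either column has a basis in which \<open>q\<close> can be exchanged for \<open>p\<close>,
  and doing so in one column or in the other gives the same sum.
\<close>

section \<open>Submodular functions\<close>

text \<open>Values lie in an arbitrary \<open>linordered_idom\<close>, so one argument yields real
  decompositions over \<open>real\<close> and integral ones over \<open>int\<close>. The ground set
  \<open>E\<close> is explicit to allow induction on it.\<close>

definition submodular_on :: "'a set \<Rightarrow> ('a set \<Rightarrow> 'b::linordered_idom) \<Rightarrow> bool" where
  "submodular_on E f \<longleftrightarrow> (\<forall>A B. A \<subseteq> E \<longrightarrow> B \<subseteq> E \<longrightarrow> f (A \<union> B) + f (A \<inter> B) \<le> f A + f B)"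

lemma submodular_onD:
  "submodular_on E f \<Longrightarrow> A \<subseteq> E \<Longrightarrow> B \<subseteq> E \<Longrightarrow> f (A \<union> B) + f (A \<inter> B) \<le> f A + f B"
  by (simp add: submodular_on_def)

text \<open>Prescribing the value \<open>c\<close> at \<open>e\<close> turns the bound
  \<open>f\<close> on subsets of \<open>insert e E\<close> into this bound on subsets of
  \<open>E\<close>. It stays submodular since, whichever terms attain the minima at \<open>A\<close>
  and \<open>B\<close>, an inequality for \<open>f\<close> applies; in the mixed cases
  \<open>e\<close> goes to the union and not to the intersection.\<close>

lemma submodular_on_min:
  fixes f :: "'a set \<Rightarrow> 'b::linordered_idom"
  assumes f: "submodular_on (insert e E) f" and e: "e \<notin> E"
  shows "submodular_on E (\<lambda>A. min (f A) (f (insert e A) - c))"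
  unfolding submodular_on_def
proof (intro allI impI)
  fix A B assume AB: "A \<subseteq> E" "B \<subseteq> E"
  have [simp]: "A \<inter> insert e B = A \<inter> B" "insert e A \<inter> B = A \<inter> B" using AB e by auto
  have 1: "f (A \<union> B) + f (A \<inter> B) \<le> f A + f B"
    using AB by (intro submodular_onD[OF f]) auto
  have 2: "f (insert e (A \<union> B)) + f (A \<inter> B) \<le> f A + f (insert e B)"
    using AB submodular_onD[OF f, of A "insert e B"] by auto
  have 3: "f (insert e (A \<union> B)) + f (A \<inter> B) \<le> f (insert e A) + f B"
    using AB submodular_onD[OF f, of "insert e A" B] by auto
  have 4: "f (insert e (A \<union> B)) + f (insert e (A \<inter> B)) \<le> f (insert e A) + f (insert e B)"
    using AB submodular_onD[OF f, of "insert e A" "insert e B"] by auto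
  define m where "m = (\<lambda>A. min (f A) (f (insert e A) - c))"
  have le: "m X \<le> f X" "m X \<le> f (insert e X) - c" for X
    by (simp_all add: m_def)
  have eq: "m X = f X \<or> m X = f (insert e X) - c" for X
    by (simp add: m_def min_def)
  have "m (A \<union> B) + m (A \<inter> B) \<le> m A + m B"
    using eq[of A] eq[of B] 1 2 3 4
      le(1)[of "A \<union> B"] le(1)[of "A \<inter> B"] le(2)[of "A \<union> B"] le(2)[of "A \<inter> B"]
    by (elim disjE; linarith)
  then show "min (f (A \<union> B)) (f (insert e (A \<union> B)) - c) +
           min (f (A \<inter> B)) (f (insert e (A \<inter> B)) - c)
           \<le> min (f A) (f (insert e A) - c) + min (f B) (f (insert e B) - c)"
    by (simp add: m_def)
qed

text \<open>This is Frank's discrete sandwich theorem: a modular function fits between the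
  supermodular \<open>- g\<close> and the submodular \<open>f\<close>. Elements are removed one at a
  time and a value is chosen for each; no division occurs, so over \<open>int\<close> the solution
  is integral.\<close>

lemma submodular_on_sandwich:
  fixes f g :: "'a set \<Rightarrow> 'b::linordered_idom"
  assumes "finite E" "submodular_on E f" "submodular_on E g"
    and "\<And>A. A \<subseteq> E \<Longrightarrow> 0 \<le> f A + g A" "f {} = 0" "g {} = 0"
  shows "\<exists>x. \<forall>A\<subseteq>E. sum x A \<le> f A \<and> - sum x A \<le> g A"
  using assms
proof (induction E arbitrary: f g rule: finite_induct)
  case empty
  then show ?case by auto
next
  case (insert e E f g)
  \<comment> \<open>The least \<open>c\<close> with \<open>0 \<le> f A + g (insert e A) + c\<close>
    for all \<open>A \<subseteq> E\<close>. The opposite mixed condition bounds \<open>c\<close>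
    from above and is the content of \<open>c_le\<close>.\<close>
  define c where "c = Max ((\<lambda>A. - g (insert e A) - f A) ` Pow E)"
  have fin: "finite ((\<lambda>A. - g (insert e A) - f A) ` Pow E)" using insert.hyps by simp
  have c_ge: "- g (insert e A) - f A \<le> c" if "A \<subseteq> E" for A
    unfolding c_def using that by (intro Max_ge[OF fin]) auto
  have c_le: "c \<le> f (insert e B) + g B" if B: "B \<subseteq> E" for B
  proof -
    have "- g (insert e A) - f A \<le> f (insert e B) + g B" if A: "A \<subseteq> E" for A
    proof -
      have [simp]: "A \<inter> insert e B = A \<inter> B" "insert e A \<inter> B = A \<inter> B"
        using insert.hyps(2) A B by auto
      \<comment> \<open>Uncrossing: the pairs used for \<open>f\<close> and for \<open>g\<close>
        have the same union \<open>insert e (A \<union> B)\<close> and the same intersection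
        \<open>A \<inter> B\<close>, and at both sets \<open>f + g\<close> is nonnegative.\<close>
      have "0 \<le> f (insert e (A \<union> B)) + g (insert e (A \<union> B))" "0 \<le> f (A \<inter> B) + g (A \<inter> B)"
        using A B by (auto intro!: insert.prems(3))
      moreover have "f (insert e (A \<union> B)) + f (A \<inter> B) \<le> f A + f (insert e B)"
        using A B submodular_onD[OF insert.prems(1), of A "insert e B"] by auto
      moreover have "g (insert e (A \<union> B)) + g (A \<inter> B) \<le> g (insert e A) + g B"
        using A B submodular_onD[OF insert.prems(2), of "insert e A" B] by auto
      ultimately show ?thesis by linarith
    qed
    then show ?thesis unfolding c_def using fin by (subst Max_le_iff) auto
  qed
  let ?f = "\<lambda>A. min (f A) (f (insert e A) - c)" and ?g = "\<lambda>A. min (g A) (g (insert e A) - (- c))"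
  have "\<exists>x. \<forall>A\<subseteq>E. sum x A \<le> ?f A \<and> - sum x A \<le> ?g A"
  proof (rule insert.IH)
    show "submodular_on E ?f" "submodular_on E ?g"
      by (rule submodular_on_min[OF insert.prems(1) insert.hyps(2)],
          rule submodular_on_min[OF insert.prems(2) insert.hyps(2)])
    show "0 \<le> ?f A + ?g A" if "A \<subseteq> E" for A
    proof -
      have "0 \<le> f A + g A" "0 \<le> f (insert e A) + g (insert e A)"
        using that by (auto intro!: insert.prems(3))
      then show ?thesis using c_ge[OF that] c_le[OF that]
        by linarith
    qed
    show "?f {} = 0" using c_le[of "{}"] insert.prems(4,5) by simp
    show "?g {} = 0" using c_ge[of "{}"] insert.prems(4,5) by simp
  qed
  then obtain x where x: "\<forall>A\<subseteq>E. sum x A \<le> ?f A \<and> - sum x A \<le> ?g A" by blast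
  define y where "y = x(e := c)"
  have y: "sum y A = sum x A" if "A \<subseteq> E" for A
    using that insert.hyps(2) unfolding y_def by (intro sum.cong) auto
  show ?case
  proof (intro exI[of _ y] allI impI)
    fix A assume A: "A \<subseteq> insert e E"
    show "sum y A \<le> f A \<and> - sum y A \<le> g A"
    proof (cases "e \<in> A")
      case True
      define B where "B = A - {e}"
      have B: "B \<subseteq> E" "A = insert e B" "e \<notin> B" using A True by (auto simp: B_def)
      have "finite B" using B insert.hyps finite_subset by blast
      then have "sum y A = c + sum x B" using B y by (simp add: y_def)
      then show ?thesis using x[rule_format, OF B(1)] B(2) by (simp add: algebra_simps)
    next
      case False
      then have "A \<subseteq> E" using A by auto
      then show ?thesis using x[rule_format, of A] y by simp
    qed
  qed
qed

section \<open>Splitting a point into bases of several submodular functions\<close>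

lemma submodular_on_diff_sum:
  fixes f :: "'a set \<Rightarrow> 'b::linordered_idom"
  assumes "submodular_on E f" "finite E"
  shows "submodular_on E (\<lambda>A. f A - sum \<alpha> A)"
  unfolding submodular_on_def
proof (intro allI impI)
  fix A B assume AB: "A \<subseteq> E" "B \<subseteq> E"
  then have "sum \<alpha> (A \<union> B) + sum \<alpha> (A \<inter> B) = sum \<alpha> A + sum \<alpha> B"
    using assms(2) finite_subset by (intro sum.union_inter) blast+
  with submodular_onD[OF assms(1) AB]
  show "f (A \<union> B) - sum \<alpha> (A \<union> B) + (f (A \<inter> B) - sum \<alpha> (A \<inter> B))
      \<le> f A - sum \<alpha> A + (f B - sum \<alpha> B)" by linarith
qed

lemma submodular_on_sum:
  fixes f :: "'k \<Rightarrow> 'a set \<Rightarrow> 'b::linordered_idom"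
  assumes "\<And>k. k \<in> K \<Longrightarrow> submodular_on E (f k)"
  shows "submodular_on E (\<lambda>A. \<Sum>k\<in>K. f k A)"
  unfolding submodular_on_def sum.distrib[symmetric]
  using submodular_onD[OF assms] by (intro allI impI sum_mono)

text \<open>The sandwich theorem splits one summand \<open>y\<close> off \<open>\<alpha>\<close> at
  a time, with \<open>y\<close> below \<open>f k\<close> and the rest below the remaining sum. For
  polymatroids this says that base polytopes add up, and over \<open>int\<close> that their lattice
  points do so as well.\<close>

lemma submodular_base_decomposition:
  fixes f :: "'k \<Rightarrow> 'a set \<Rightarrow> 'b::linordered_idom"
  assumes "finite K" "finite E"
    and "\<And>k. k \<in> K \<Longrightarrow> submodular_on E (f k)" "\<And>k. k \<in> K \<Longrightarrow> f k {} = 0"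
    and "\<And>A. A \<subseteq> E \<Longrightarrow> sum \<alpha> A \<le> (\<Sum>k\<in>K. f k A)" "sum \<alpha> E = (\<Sum>k\<in>K. f k E)"
  shows "\<exists>x. (\<forall>e\<in>E. \<alpha> e = (\<Sum>k\<in>K. x k e)) \<and>
           (\<forall>k\<in>K. sum (x k) E = f k E \<and> (\<forall>A\<subseteq>E. sum (x k) A \<le> f k A))"
  using assms(1,3-)
proof (induction K arbitrary: \<alpha> rule: finite_induct)
  case empty
  have "0 \<le> - \<alpha> e" if "e \<in> E" for e using empty(3)[of "{e}"] that by simp
  moreover have "(\<Sum>e\<in>E. - \<alpha> e) = 0" using empty(4) by (simp add: sum_negf)
  ultimately have "\<forall>e\<in>E. - \<alpha> e = 0"
    using assms(2) sum_nonneg_eq_0_iff[of E "\<lambda>e. - \<alpha> e"] by simp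
  then show ?case by simp
next
  case (insert k K)
  have "\<exists>y. \<forall>A\<subseteq>E. sum y A \<le> f k A \<and> - sum y A \<le> (\<Sum>k\<in>K. f k A) - sum \<alpha> A"
  proof (rule submodular_on_sandwich)
    show "submodular_on E (\<lambda>A. (\<Sum>k\<in>K. f k A) - sum \<alpha> A)"
      using insert.prems(1) by (intro submodular_on_diff_sum submodular_on_sum assms(2)) auto
    show "0 \<le> f k A + ((\<Sum>k\<in>K. f k A) - sum \<alpha> A)" if "A \<subseteq> E" for A
      using insert.prems(3)[OF that] insert.hyps by simp
    show "submodular_on E (f k)" "f k {} = 0" "(\<Sum>k\<in>K. f k {}) - sum \<alpha> {} = 0"
      using insert.prems(1,2) by simp_all
  qed (rule assms(2))
  then obtain y where y': "\<forall>A\<subseteq>E. sum y A \<le> f k A \<and> - sum y A \<le> (\<Sum>k\<in>K. f k A) - sum \<alpha> A"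
    by blast
  have y: "sum y A \<le> f k A" "sum \<alpha> A - sum y A \<le> (\<Sum>k\<in>K. f k A)" if "A \<subseteq> E" for A
    using y'[rule_format, OF that] by linarith+
  \<comment> \<open>On \<open>E\<close> the two upper bounds add up to
    \<open>sum \<alpha> E\<close>, so both are equalities.\<close>
  have yE: "sum y E = f k E" "sum \<alpha> E - sum y E = (\<Sum>k\<in>K. f k E)"
    using y[of E] insert.prems(4) insert.hyps by simp_all
  have "\<exists>x. (\<forall>e\<in>E. \<alpha> e - y e = (\<Sum>k\<in>K. x k e)) \<and>
           (\<forall>k\<in>K. sum (x k) E = f k E \<and> (\<forall>A\<subseteq>E. sum (x k) A \<le> f k A))"
  proof (rule insert.IH)
    show "(\<Sum>e\<in>A. \<alpha> e - y e) \<le> (\<Sum>k\<in>K. f k A)" if "A \<subseteq> E" for A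
      using y(2)[OF that] by (simp add: sum_subtractf)
    show "(\<Sum>e\<in>E. \<alpha> e - y e) = (\<Sum>k\<in>K. f k E)"
      using yE(2) by (simp add: sum_subtractf)
  qed (use insert.prems(1,2) in simp_all)
  then obtain x where x: "\<forall>e\<in>E. \<alpha> e - y e = (\<Sum>k\<in>K. x k e)"
           "\<forall>k\<in>K. sum (x k) E = f k E \<and> (\<forall>A\<subseteq>E. sum (x k) A \<le> f k A)" by blast
  have upd: "(\<Sum>k'\<in>K. (x(k := y)) k' e) = (\<Sum>k\<in>K. x k e)" for e
    using insert.hyps by (intro sum.cong) auto
  show ?case
  proof (intro exI[of _ "x(k := y)"] conjI ballI)
    fix e assume "e \<in> E"
    then show "\<alpha> e = (\<Sum>k'\<in>insert k K. (x(k := y)) k' e)"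
      using x(1)[rule_format, of e] insert.hyps upd[of e] by (simp add: algebra_simps)
  next
    fix k' assume "k' \<in> insert k K"
    then show "sum ((x(k := y)) k') E = f k' E"
      using x(2) yE(1) by (cases "k' = k") simp_all
    show "\<forall>A\<subseteq>E. sum ((x(k := y)) k') A \<le> f k' A"
      using \<open>k' \<in> insert k K\<close> x(2) y(1) by (cases "k' = k") simp_all
  qed
qed

section \<open>The rank function of a column\<close>

definition upset :: "'a::ord set \<Rightarrow> bool" where
  "upset U \<longleftrightarrow> (\<forall>x\<in>U. \<forall>y\<ge>x. y \<in> U)"

lemma upset_atLeast: "upset {p::'a::preorder..}"
  by (auto simp: upset_def intro: order_trans)

lemma upset_greaterThan: "upset {p::'a::preorder<..}"
  by (auto simp: upset_def intro: less_le_trans)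

lemma upset_chain: "upset U \<Longrightarrow> upset V \<Longrightarrow> U \<subseteq> V \<or> V \<subseteq> (U :: 'a::linorder set)"
  by (metis upset_def linear subsetI)

section \<open>The min-max formula for the parenthesis count\<close>

abbreviation count_in :: "'a set \<Rightarrow> 'a list \<Rightarrow> nat" where
  "count_in A xs \<equiv> length (filter (\<lambda>i. i \<in> A) xs)"

text \<open>\<open>theta_column\<close> restricted to the rows in \<open>xs\<close>, with \<open>k\<close> left parentheses open at the start.\<close>

definition theta_rows :: "'a set \<Rightarrow> 'a set \<Rightarrow> nat \<Rightarrow> 'a list \<Rightarrow> nat" where
  "theta_rows C I k xs = (let w = concat (map
     (\<lambda>i. if i \<notin> C \<and> i \<in> I then [LParen]
          else if i \<in> C \<and> i \<notin> I then [RParen]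
          else if i \<in> C \<and> i \<in> I then [Star]
          else []) xs) in matched_pairs k w + count_list w Star)"

lemma theta_column_eq_theta_rows:
  "theta_column C I = theta_rows C I 0 (sorted_list_of_set UNIV)"
  by (simp add: theta_column_def column_word_def theta_rows_def Let_def)

lemma theta_rows_Nil [simp]: "theta_rows C I k [] = 0"
  by (simp add: theta_rows_def)

lemma theta_rows_Cons:
  "x \<in> I \<Longrightarrow> x \<notin> C \<Longrightarrow> theta_rows C I k (x # xs) = theta_rows C I (Suc k) xs"
  "x \<notin> I \<Longrightarrow> x \<in> C \<Longrightarrow> theta_rows C I 0 (x # xs) = theta_rows C I 0 xs"
  "x \<notin> I \<Longrightarrow> x \<in> C \<Longrightarrow> theta_rows C I (Suc k) (x # xs) = Suc (theta_rows C I k xs)"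
  "x \<in> I \<Longrightarrow> x \<in> C \<Longrightarrow> theta_rows C I k (x # xs) = Suc (theta_rows C I k xs)"
  "x \<notin> I \<Longrightarrow> x \<notin> C \<Longrightarrow> theta_rows C I k (x # xs) = theta_rows C I k xs"
  by (auto simp: theta_rows_def Let_def)

text \<open>Each star and each matched pair has a box of its own: the row of the star or of the
  right parenthesis.\<close>

lemma theta_rows_le_count: "theta_rows C I k xs \<le> count_in C xs"
proof (induction xs arbitrary: k)
  case (Cons x xs)
  show ?case
    using Cons[of k] Cons[of "Suc k"] Cons[of "k - 1"]
    by (cases "x \<in> I"; cases "x \<in> C"; cases k) (simp_all add: theta_rows_Cons)
qed simp

text \<open>A star or right parenthesis in \<open>U\<close> is counted by
  \<open>C \<inter> U\<close>. Outside \<open>U\<close> a star lies in \<open>I - U\<close>, and a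
  matched right parenthesis has its partner earlier, hence in \<open>I - U\<close> or among the
  \<open>k\<close> initially open ones.\<close>

lemma theta_rows_le_cut:
  assumes "upset U" "sorted xs"
  shows "theta_rows C I k xs \<le> k + count_in (C \<inter> U) xs + count_in (I - U) xs"
  using assms(2)
proof (induction xs arbitrary: k)
  case (Cons x xs)
  show ?case
  proof (cases "x \<in> U")
    case True
    then have "set (x # xs) \<subseteq> U" using assms(1) Cons.prems by (auto simp: upset_def)
    then have "filter (\<lambda>i. i \<in> C) (x # xs) = filter (\<lambda>i. i \<in> C \<inter> U) (x # xs)"
      by (intro filter_cong) auto
    then show ?thesis using theta_rows_le_count[of C I k "x # xs"] by simp
  next
    case False
    have "sorted xs" using Cons.prems by simp
    note IH = Cons.IH[OF this]
    show ?thesis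
      using IH[of k] IH[of "Suc k"] IH[of "k - 1"] False
      by (cases "x \<in> I"; cases "x \<in> C"; cases k) (simp_all add: theta_rows_Cons)
  qed
qed simp

text \<open>If some right parenthesis is unmatched, the cut comes right after the last such one:
  before it every left parenthesis, including the \<open>k\<close> initial ones, has been closed,
  and after it every right parenthesis is matched.\<close>

lemma theta_rows_attained:
  "theta_rows C I k xs = count_in C xs \<or>
   (\<exists>us vs. xs = us @ vs \<and> theta_rows C I k xs = k + count_in I us + count_in C vs)"
proof (induction xs arbitrary: k)
  case (Cons x xs)
  \<comment> \<open>The number of parentheses open after row \<open>x\<close>; truncated subtraction
    leaves it at 0 when \<open>x\<close> is an unmatched right parenthesis.\<close>
  define k' where "k' = (if x \<in> I \<and> x \<notin> C then Suc k else if x \<notin> I \<and> x \<in> C then k - 1 else k)"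
  from Cons[of k'] show ?case
  proof (elim disjE exE conjE)
    assume *: "theta_rows C I k' xs = count_in C xs"
    show ?thesis
    proof (cases "x \<notin> I \<and> x \<in> C \<and> k = 0")
      case True
      then have "theta_rows C I k (x # xs) = k + count_in I [x] + count_in C xs"
        using * by (simp add: theta_rows_Cons k'_def)
      then show ?thesis by (intro disjI2 exI[of _ "[x]"] exI[of _ xs] conjI) simp_all
    next
      case False
      then have "theta_rows C I k (x # xs) = count_in C (x # xs)"
        using * unfolding k'_def
        by (cases "x \<in> I"; cases "x \<in> C"; cases k) (simp_all add: theta_rows_Cons)
      then show ?thesis by (rule disjI1)
    qed
  next
    fix us vs assume *: "xs = us @ vs" "theta_rows C I k' xs = k' + count_in I us + count_in C vs"
    have "theta_rows C I k (x # xs) = k + count_in I (x # us) + count_in C vs"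
    proof (cases "x \<in> I"; cases "x \<in> C"; cases k)
      qed (insert *(2), simp_all add: theta_rows_Cons k'_def)
    then show ?thesis
      using *(1) by (intro disjI2 exI[of _ "x # us"] exI[of _ vs] conjI) simp_all
  qed
qed simp

lemma count_in_card: "distinct xs \<Longrightarrow> count_in A xs = card (A \<inter> set xs)"
  by (simp add: distinct_length_filter Int_commute)

lemma theta_column_le:
  assumes "upset U"
  shows "theta_column C I \<le> card (C \<inter> U) + card (I - U)"
  using theta_rows_le_cut[OF assms sorted_sorted_list_of_set[of UNIV], of C I 0]
  unfolding theta_column_eq_theta_rows count_in_card[OF distinct_sorted_list_of_set] by simp

text \<open>The suffix \<open>vs\<close> of the optimal cut is an up-set, since all rows are listed
  in increasing order. When every box is counted, \<open>UNIV\<close> serves instead.\<close>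

lemma theta_column_attained:
  "\<exists>U. upset U \<and> theta_column C I = card (C \<inter> U) + card (I - U)"
proof -
  let ?xs = "sorted_list_of_set (UNIV :: 'a set)"
  note th = theta_column_eq_theta_rows[of C I]
  from theta_rows_attained[of C I 0 ?xs] show ?thesis
  proof (elim disjE exE conjE)
    assume "theta_rows C I 0 ?xs = count_in C ?xs"
    then show ?thesis using th by (intro exI[of _ UNIV]) (auto simp: upset_def count_in_card)
  next
    fix us vs assume *: "?xs = us @ vs" "theta_rows C I 0 ?xs = 0 + count_in I us + count_in C vs"
    have d: "distinct (us @ vs)" "sorted (us @ vs)" "set (us @ vs) = UNIV"
      unfolding *(1)[symmetric] by simp_all
    then have us: "set us = - set vs" by auto
    have "upset (set vs)"
      unfolding upset_def
    proof (intro ballI allI impI)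
      fix x y assume "x \<in> set vs" "x \<le> y"
      moreover have "y \<in> set us \<Longrightarrow> y \<le> x" using d(2) \<open>x \<in> set vs\<close> by (auto simp: sorted_append)
      ultimately show "y \<in> set vs" using us by (metis Compl_iff antisym)
    qed
    moreover have "theta_column C I = card (C \<inter> set vs) + card (I - set vs)"
      using *(2) th d(1) us by (simp add: count_in_card Diff_eq)
    ultimately show ?thesis by blast
  qed
qed

text \<open>Optimal up-sets \<open>U\<close> for \<open>I\<close> and \<open>V\<close> for
  \<open>J\<close> are nested. The larger one is used for \<open>I \<union> J\<close> and the
  smaller one for \<open>I \<inter> J\<close>; the contribution of \<open>C\<close> does not change
  and that of the rows outside does not grow.\<close>

lemma submodular_theta_column:
  "submodular_on UNIV (\<lambda>I. of_nat (theta_column C I) :: 'b::linordered_idom)"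
  unfolding submodular_on_def
proof (intro allI impI)
  fix I J :: "'a set"
  have *: "theta_column C (I \<union> J) + theta_column C (I \<inter> J) \<le> theta_column C I + theta_column C J"
  proof -
    have "theta_column C (I \<union> J) + theta_column C (I \<inter> J)
        \<le> card (C \<inter> U) + card (I - U) + (card (C \<inter> V) + card (J - V))"
      if UV: "upset U" "upset V" "U \<subseteq> V \<or> V \<subseteq> U" for U V
    proof -
      have "\<exists>P Q. upset P \<and> upset Q \<and> card (C \<inter> P) + card (C \<inter> Q) = card (C \<inter> U) + card (C \<inter> V) \<and>
         card (I \<union> J - P) + card (I \<inter> J - Q) \<le> card (I - U) + card (J - V)"
        using UV(3)
      proof
        assume s: "U \<subseteq> V"
        have "card (I \<union> J - V) + card (I \<inter> J - U) = card ((I \<union> J - V) \<union> (I \<inter> J - U)) + card ((I \<union> J - V) \<inter> (I \<inter> J - U))"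
          by (rule card_Un_Int) auto
        also have "\<dots> \<le> card ((I - U) \<union> (J - V)) + card ((I - U) \<inter> (J - V))"
          using s by (intro add_mono card_mono) auto
        also have "\<dots> = card (I - U) + card (J - V)" by (rule card_Un_Int[symmetric]) auto
        finally show ?thesis using UV by (intro exI[of _ V] exI[of _ U]) auto
      next
        assume s: "V \<subseteq> U"
        have "card (I \<union> J - U) + card (I \<inter> J - V) = card ((I \<union> J - U) \<union> (I \<inter> J - V)) + card ((I \<union> J - U) \<inter> (I \<inter> J - V))"
          by (rule card_Un_Int) auto
        also have "\<dots> \<le> card ((I - U) \<union> (J - V)) + card ((I - U) \<inter> (J - V))"
          using s by (intro add_mono card_mono) auto
        also have "\<dots> = card (I - U) + card (J - V)" by (rule card_Un_Int[symmetric]) auto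
        finally show ?thesis using UV by (intro exI[of _ U] exI[of _ V]) auto
      qed
      then obtain P Q where "upset P" "upset Q"
        "card (C \<inter> P) + card (C \<inter> Q) = card (C \<inter> U) + card (C \<inter> V)"
        "card (I \<union> J - P) + card (I \<inter> J - Q) \<le> card (I - U) + card (J - V)" by blast
      then show ?thesis
        using theta_column_le[of P C "I \<union> J"] theta_column_le[of Q C "I \<inter> J"] by linarith
    qed
    then show ?thesis
      using theta_column_attained[of C I] theta_column_attained[of C J] upset_chain by metis
  qed
  show "of_nat (theta_column C (I \<union> J)) + of_nat (theta_column C (I \<inter> J)) \<le>
        of_nat (theta_column C I) + (of_nat (theta_column C J) :: 'b)"
    using * by (simp flip: of_nat_add add: of_nat_le_iff)
qed

lemma theta_column_empty: "theta_column C {} = 0"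
  using theta_column_le[of "{}" C "{}"] by (auto simp: upset_def)

lemma theta_column_UNIV: "theta_column C UNIV = card C"
proof (rule antisym)
  show "theta_column C UNIV \<le> card C" using theta_column_le[of UNIV C UNIV] by (auto simp: upset_def)
  obtain U where U: "theta_column C UNIV = card (C \<inter> U) + card (- U)"
    using theta_column_attained[of C UNIV] by (auto simp: Compl_eq_Diff_UNIV)
  have "card C = card (C \<inter> U) + card (C - U)" using card_Int_Diff[of C U] by simp
  also have "card (C - U) \<le> card (- U)" by (intro card_mono) auto
  finally show "card C \<le> theta_column C UNIV" using U by simp
qed

lemma theta_column_mono: "I \<subseteq> J \<Longrightarrow> theta_column C I \<le> theta_column C J"
proof -
  assume "I \<subseteq> J"
  obtain U where "upset U" "theta_column C J = card (C \<inter> U) + card (J - U)"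
    using theta_column_attained by blast
  moreover have "card (I - U) \<le> card (J - U)" using \<open>I \<subseteq> J\<close> by (intro card_mono) auto
  ultimately show ?thesis using theta_column_le[of U C I] by simp
qed

lemma theta_column_le_card: "theta_column C I \<le> card I"
  using theta_column_le[of "{}" C I] by (auto simp: upset_def)

section \<open>Gale order and movable intervals\<close>

text \<open>Moves counting from rows to positions in the sorted list, in terms of which
  \<open>gale_le\<close> is stated.\<close>

lemma card_Int_eq_card_nth:
  fixes T :: "'n::{finite,linorder} set"
  shows "card (T \<inter> U) = card {i. i < card T \<and> sorted_list_of_set T ! i \<in> U}"
proof -
  let ?xs = "sorted_list_of_set T"
  have "T \<inter> U = (!) ?xs ` {i. i < card T \<and> ?xs ! i \<in> U}"
    using set_sorted_list_of_set[of T] by (auto simp: set_conv_nth)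
  moreover have "inj_on ((!) ?xs) {i. i < card T \<and> ?xs ! i \<in> U}"
    by (rule inj_on_nth) auto
  ultimately show ?thesis by (simp add: card_image)
qed

text \<open>If the entry of \<open>T\<close> at position \<open>i\<close> exceeds that of
  \<open>S\<close>, the up-set starting at it contains at least \<open>card T - i\<close> elements
  of \<open>T\<close> but at most \<open>card S - Suc i\<close> of \<open>S\<close>. Conversely,
  positions whose entry of \<open>T\<close> lies in an up-set have their entry of \<open>S\<close>
  there too.\<close>

lemma gale_le_iff_upset:
  fixes S T :: "'n::{finite,linorder} set"
  shows "gale_le T S \<longleftrightarrow> card T = card S \<and> (\<forall>U. upset U \<longrightarrow> card (T \<inter> U) \<le> card (S \<inter> U))"
proof (intro iffI conjI allI impI)
  assume *: "gale_le T S"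
  then show c: "card T = card S" by (simp add: gale_le_def)
  fix U :: "'n set" assume U: "upset U"
  have "{i. i < card T \<and> sorted_list_of_set T ! i \<in> U} \<subseteq> {i. i < card S \<and> sorted_list_of_set S ! i \<in> U}"
    using * U by (auto simp: gale_le_def upset_def)
  then show "card (T \<inter> U) \<le> card (S \<inter> U)"
    unfolding card_Int_eq_card_nth[of T] card_Int_eq_card_nth[of S] by (intro card_mono) auto
next
  assume *: "card T = card S \<and> (\<forall>U. upset U \<longrightarrow> card (T \<inter> U) \<le> card (S \<inter> U))"
  let ?t = "\<lambda>i. sorted_list_of_set T ! i" and ?s = "\<lambda>i. sorted_list_of_set S ! i"
  have "?t i \<le> ?s i" if i: "i < card S" for i
  proof (rule ccontr)
    assume "\<not> ?t i \<le> ?s i"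
    then have less: "?s i < ?t i" by simp
    have "{i..<card T} \<subseteq> {k. k < card T \<and> ?t k \<in> {?t i..}}"
      using sorted_nth_mono[OF sorted_sorted_list_of_set[of T], of i] i by auto
    then have "card T - i \<le> card {k. k < card T \<and> ?t k \<in> {?t i..}}"
      using card_mono[of "{k. k < card T \<and> ?t k \<in> {?t i..}}" "{i..<card T}"] by simp
    moreover have "{k. k < card S \<and> ?s k \<in> {?t i..}} \<subseteq> {Suc i..<card S}"
    proof
      fix k assume k: "k \<in> {k. k < card S \<and> ?s k \<in> {?t i..}}"
      then have "?s i < ?s k" using less by (auto intro: less_le_trans)
      then have "\<not> k \<le> i"
        using sorted_nth_mono[OF sorted_sorted_list_of_set[of S], of k i] i by auto
      then show "k \<in> {Suc i..<card S}" using k by auto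
    qed
    then have "card {k. k < card S \<and> ?s k \<in> {?t i..}} \<le> card S - Suc i"
      using card_mono[of "{Suc i..<card S}"] by fastforce
    moreover have "card (T \<inter> {?t i..}) \<le> card (S \<inter> {?t i..})"
      using * upset_atLeast by blast
    ultimately show False
      using * i unfolding card_Int_eq_card_nth[of T] card_Int_eq_card_nth[of S] by linarith
  qed
  then show "gale_le T S" using * by (simp add: gale_le_def)
qed

lemma gale_le_refl: "gale_le S S"
  by (simp add: gale_le_def)

text \<open>For an optimal up-set \<open>U\<close>, the part of \<open>T \<inter> I\<close> in
  \<open>U\<close> is bounded through the Gale order and the part outside by
  \<open>card (I - U)\<close>.\<close>

lemma gale_le_card_Int_le_theta_column:
  fixes S T :: "'n::{finite,linorder} set"
  assumes "gale_le T S"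
  shows "card (T \<inter> I) \<le> theta_column S I"
proof -
  obtain U where U: "upset U" "theta_column S I = card (S \<inter> U) + card (I - U)"
    using theta_column_attained by blast
  have "card (T \<inter> I) \<le> card ((T \<inter> U) \<union> (I - U))" by (intro card_mono) auto
  also have "\<dots> \<le> card (T \<inter> U) + card (I - U)" by (rule card_Un_le)
  also have "card (T \<inter> U) \<le> card (S \<inter> U)" using assms U(1) by (simp add: gale_le_iff_upset)
  finally show ?thesis using U(2) by simp
qed

text \<open>Every up-set containing \<open>y\<close> contains \<open>x\<close>, so moving an element
  from \<open>x\<close> up to \<open>y\<close> increases no count over an up-set.\<close>

lemma gale_le_exchange:
  fixes S T :: "'n::{finite,linorder} set"
  assumes "gale_le T S" "x \<in> T" "y \<notin> T" "y < x"
  shows "gale_le (insert y (T - {x})) S"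
  unfolding gale_le_iff_upset
proof (intro conjI allI impI)
  have "card T = Suc (card (T - {x}))" using assms(2) card.remove[of T x] by simp
  then show "card (insert y (T - {x})) = card S"
    using assms by (simp add: gale_le_def)
  fix U :: "'n set" assume U: "upset U"
  have "card (insert y (T - {x}) \<inter> U) \<le> card (T \<inter> U)"
  proof (cases "x \<in> U")
    case True
    have "insert y (T - {x}) \<inter> U \<subseteq> insert y ((T \<inter> U) - {x})" by auto
    then have "card (insert y (T - {x}) \<inter> U) \<le> card (insert y ((T \<inter> U) - {x}))"
      by (intro card_mono) auto
    also have "\<dots> \<le> Suc (card ((T \<inter> U) - {x}))" by (rule card_insert_le_m1) simp_all
    also have "\<dots> = card (T \<inter> U)" using True assms(2) card.remove[of "T \<inter> U" x] by simp
    finally show ?thesis .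
  next
    case False
    then have "y \<notin> U" using U assms(4) by (auto simp: upset_def)
    then show ?thesis by (intro card_mono) auto
  qed
  also have "\<dots> \<le> card (S \<inter> U)" using assms(1) U by (simp add: gale_le_iff_upset)
  finally show "card (insert y (T - {x}) \<inter> U) \<le> card (S \<inter> U)" .
qed

section \<open>Movable intervals\<close>

lemma movable_interval_bounds:
  fixes C :: "'n::{finite,linorder} set"
  assumes "i \<in> movable_interval C"
  obtains a b where "a \<notin> C" "b \<in> C" "movable_interval C = {a..b}" "a < b"
proof -
  have *: "C \<noteq> UNIV" "C \<noteq> {}" "Min (UNIV - C) < Max C"
    "movable_interval C = {Min (UNIV - C)..Max C}"
    using assms by (auto simp: movable_interval_def split: if_splits)
  have "Min (UNIV - C) \<in> UNIV - C" "Max C \<in> C"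
    using * by (intro Min_in Max_in; auto)+
  then show ?thesis using that * by blast
qed

text \<open>Rows above the first gap all hold boxes and rows below the last box hold none. If the
  first gap comes after the last box, these two cases exhaust all rows.\<close>

lemma not_in_movable_interval:
  fixes C :: "'n::{finite,linorder} set"
  assumes "i \<notin> movable_interval C"
  shows "{..i} \<subseteq> C \<or> {i..} \<inter> C = {}"
proof (cases "C = UNIV \<or> C = {}")
  case False
  have 1: "k \<in> C" if "k < Min (UNIV - C)" for k
    using that Min_le[of "UNIV - C" k] by (auto simp: not_less[symmetric])
  have 2: "k \<notin> C" if "k > Max C" for k
    using that Max_ge[of C k] by (auto simp: not_less[symmetric])
  show ?thesis
  proof (cases "Min (UNIV - C) < Max C")
    case True
    then have "i < Min (UNIV - C) \<or> i > Max C"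
      using assms False unfolding movable_interval_def
      by (metis atLeastAtMost_iff linorder_not_le)
    then show ?thesis using 1 2 le_less_trans less_le_trans by (fastforce simp: disjoint_iff)
  next
    case le: False
    show ?thesis
    proof (cases "i < Min (UNIV - C)")
      case True
      then show ?thesis using 1 le_less_trans by fastforce
    next
      case False
      have "Min (UNIV - C) \<in> UNIV - C" "Max C \<in> C"
        using \<open>\<not> (C = UNIV \<or> C = {})\<close> by (intro Min_in Max_in; auto)+
      then have "Max C \<noteq> Min (UNIV - C)" by auto
      then have "i > Max C" using le False by order
      then show ?thesis using 2 less_le_trans by (fastforce simp: disjoint_iff)
    qed
  qed
qed auto

text \<open>Starting from \<open>C\<close>, the last box \<open>b\<close> is moved up to
  \<open>q\<close> if \<open>q\<close> is empty, and then a box at \<open>p\<close> is moved up to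
  the first gap \<open>a\<close>. Both moves go up and so stay below \<open>C\<close> in Gale
  order.\<close>

lemma movable_interval_exchange:
  fixes C :: "'n::{finite,linorder} set"
  assumes "p \<in> movable_interval C" "q \<in> movable_interval C" "p < q"
  obtains T where "gale_le T C" "q \<in> T" "p \<notin> T"
proof -
  obtain a b where ab: "a \<notin> C" "b \<in> C" "movable_interval C = {a..b}"
    using movable_interval_bounds[OF assms(1)] by blast
  have pq: "a \<le> p" "q \<le> b" "p < b" "a < q" using assms ab(3) by auto
  \<comment> \<open>The first move leaves row \<open>p\<close> as it was and keeps \<open>a\<close>
    free for the second.\<close>
  obtain T where T: "gale_le T C" "q \<in> T" "p \<in> T \<longleftrightarrow> p \<in> C" "a \<notin> T"
  proof (cases "q \<in> C")
    case True
    then show ?thesis using that[of C] ab(1) by (simp add: gale_le_refl)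
  next
    case False
    then have "q < b" using ab(2) pq by (metis order.not_eq_order_implies_strict)
    then have "gale_le (insert q (C - {b})) C"
      using gale_le_exchange[OF gale_le_refl ab(2) False] by simp
    then show ?thesis using that[of "insert q (C - {b})"] ab(1) pq assms(3) by auto
  qed
  show ?thesis
  proof (cases "p \<in> C")
    case True
    then have "a < p" using ab(1) pq(1) by (metis order.not_eq_order_implies_strict)
    then have "gale_le (insert a (T - {p})) C"
      using gale_le_exchange[OF T(1)] T(3,4) True by simp
    then show ?thesis using that[of "insert a (T - {p})"] T(2) assms(3) \<open>a < p\<close> by auto
  next
    case False
    then show ?thesis using that T by blast
  qed
qed

section \<open>Points of dilated Schubert matroid polytopes\<close>

text \<open>For \<open>t = 1\<close> and real values, the points of the base polytope of the Schubert matroid of \<open>C\<close>.\<close>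

definition schubert_points :: "nat \<Rightarrow> 'n::{finite,linorder} set \<Rightarrow> ('n \<Rightarrow> 'b::linordered_idom) set" where
  "schubert_points t C =
     {x. (\<forall>I. sum x I \<le> of_nat (t * theta_column C I)) \<and> sum x UNIV = of_nat (t * card C)}"

lemma schubert_points_sum_le:
  "x \<in> schubert_points t C \<Longrightarrow> sum x I \<le> of_nat (t * theta_column C I)"
  by (simp add: schubert_points_def)

lemma schubert_points_sum_UNIV: "x \<in> schubert_points t C \<Longrightarrow> sum x UNIV = of_nat (t * card C)"
  by (simp add: schubert_points_def)

lemma schubert_points_ge:
  fixes x :: "'n::{finite,linorder} \<Rightarrow> 'b::linordered_idom"
  assumes "x \<in> schubert_points t C"
  shows "of_nat (t * card C) - of_nat (t * theta_column C (UNIV - {i})) \<le> x i"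
proof -
  have "sum x UNIV = x i + sum x (UNIV - {i})" by (simp add: sum.remove)
  then show ?thesis
    using schubert_points_sum_le[OF assms, of "UNIV - {i}"] schubert_points_sum_UNIV[OF assms]
    by linarith
qed

lemma schubert_points_nonneg:
  fixes x :: "'n::{finite,linorder} \<Rightarrow> 'b::linordered_idom"
  assumes "x \<in> schubert_points t C"
  shows "0 \<le> x i"
proof -
  have "t * theta_column C (UNIV - {i}) \<le> t * card C"
    using theta_column_mono[of "UNIV - {i}" UNIV C] by (simp add: theta_column_UNIV)
  then have "(of_nat (t * theta_column C (UNIV - {i})) :: 'b) \<le> of_nat (t * card C)"
    by (rule of_nat_mono)
  then show ?thesis using schubert_points_ge[OF assms, of i] by linarith
qed

lemma schubert_points_le:
  fixes x :: "'n::{finite,linorder} \<Rightarrow> 'b::linordered_idom"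
  assumes "x \<in> schubert_points t C"
  shows "x i \<le> of_nat t"
proof -
  have "x i \<le> of_nat (t * theta_column C {i})"
    using schubert_points_sum_le[OF assms, of "{i}"] by simp
  also have "\<dots> \<le> of_nat t"
    using theta_column_le_card[of C "{i}"] by (intro of_nat_mono) simp
  finally show ?thesis .
qed

text \<open>Such a row is a coloop of the matroid, if the column is full down to it, or a loop, if
  the column is empty from it on. The rank bounds then force the coordinate to its extreme
  value.\<close>

lemma schubert_points_eq_outside_movable_interval:
  fixes x :: "'n::{finite,linorder} \<Rightarrow> 'b::linordered_idom"
  assumes x: "x \<in> schubert_points t C" and i: "i \<notin> movable_interval C"
  shows "x i = (if i \<in> C then of_nat t else 0)"
  using not_in_movable_interval[OF i]
proof
  assume sub: "{..i} \<subseteq> C"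
  have "theta_column C (UNIV - {i}) < card C"
  proof -
    \<comment> \<open>Cutting just below \<open>i\<close> bounds the rank without \<open>i\<close>
      by the number of boxes other than the one in row \<open>i\<close>.\<close>
    have "theta_column C (UNIV - {i}) \<le> card (C \<inter> {i<..}) + card (UNIV - {i} - {i<..})"
      by (rule theta_column_le[OF upset_greaterThan])
    also have "UNIV - {i} - {i<..} = {..<i}" by auto
    also have "card (C \<inter> {i<..}) + card {..<i} = card ((C \<inter> {i<..}) \<union> {..<i})"
      by (intro card_Un_disjoint[symmetric]) auto
    also have "\<dots> < card C" using sub by (intro psubset_card_mono) auto
    finally show ?thesis .
  qed
  then have "t * theta_column C (UNIV - {i}) + t \<le> t * card C"
    by (metis Suc_leI mult_Suc_right mult_le_mono2 add.commute)
  then have "(of_nat (t * theta_column C (UNIV - {i})) :: 'b) + of_nat t \<le> of_nat (t * card C)"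
    by (metis of_nat_add of_nat_mono)
  then have "of_nat t \<le> x i" using schubert_points_ge[OF x, of i] by linarith
  then show ?thesis using schubert_points_le[OF x, of i] sub by auto
next
  assume disj: "{i..} \<inter> C = {}"
  have "theta_column C {i} \<le> card (C \<inter> {i..}) + card ({i} - {i..})"
    by (rule theta_column_le[OF upset_atLeast])
  also have "\<dots> = 0" using disj by (simp add: Int_commute)
  finally have "x i \<le> 0" using schubert_points_sum_le[OF x, of "{i}"] by simp
  then show ?thesis using schubert_points_nonneg[OF x, of i] disj by auto
qed

lemma of_bool_in_schubert_points:
  fixes T :: "'n::{finite,linorder} set"
  assumes "gale_le T C"
  shows "(\<lambda>i. of_bool (i \<in> T) :: 'b::linordered_idom) \<in> schubert_points 1 C"
  using gale_le_card_Int_le_theta_column[OF assms] assms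
  by (simp add: schubert_points_def sum.If_cases of_bool_def Int_commute gale_le_def Collect_mem_eq)

text \<open>Entries lie between 0 and 1, so an integral point is an indicator. For an up-set
  \<open>U\<close> the rank bound is at most \<open>card (C \<inter> U)\<close>, which is the
  description of the Gale order by up-sets.\<close>

lemma int_schubert_points_1:
  fixes x :: "'n::{finite,linorder} \<Rightarrow> int"
  assumes x: "x \<in> schubert_points 1 C"
  obtains T where "gale_le T C" "x = (\<lambda>i. of_bool (i \<in> T))"
proof -
  define T where "T = {i. x i = 1}"
  have "x i = of_bool (i \<in> T)" for i
    using schubert_points_nonneg[OF x, of i] schubert_points_le[OF x, of i]
    by (auto simp: T_def)
  then have xT: "x = (\<lambda>i. of_bool (i \<in> T))" by auto
  have sum: "sum x I = int (card (T \<inter> I))" for I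
    unfolding xT by (simp add: sum.If_cases of_bool_def Int_commute)
  have "card (T \<inter> U) \<le> card (C \<inter> U)" if "upset U" for U
    using theta_column_le[OF that, of C U] schubert_points_sum_le[OF x, of U] sum[of U] by simp
  moreover have "card T = card C" using schubert_points_sum_UNIV[OF x] sum[of UNIV] by simp
  ultimately have "gale_le T C" by (simp add: gale_le_iff_upset)
  then show ?thesis using that xT by blast
qed

text \<open>The index set is arbitrary so that each column may be repeated \<open>t\<close> times;
  lattice points of the dilate by \<open>t\<close> can then be split into points of undilated
  polytopes.\<close>

lemma schubert_points_decomposition:
  fixes \<alpha> :: "'n::{finite,linorder} \<Rightarrow> 'b::linordered_idom" and C :: "'k \<Rightarrow> 'n set"
  assumes "finite K" "\<And>I. sum \<alpha> I \<le> (\<Sum>k\<in>K. of_nat (theta_column (C k) I))"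
    and "sum \<alpha> UNIV = (\<Sum>k\<in>K. of_nat (card (C k)))"
  obtains x where "\<And>k. k \<in> K \<Longrightarrow> x k \<in> schubert_points 1 (C k)" "\<And>i. \<alpha> i = (\<Sum>k\<in>K. x k i)"
proof -
  have "\<exists>x. (\<forall>e\<in>UNIV. \<alpha> e = (\<Sum>k\<in>K. x k e)) \<and>
     (\<forall>k\<in>K. sum (x k) UNIV = of_nat (theta_column (C k) UNIV) \<and>
        (\<forall>A\<subseteq>UNIV. sum (x k) A \<le> of_nat (theta_column (C k) A)))"
    using assms
    by (intro submodular_base_decomposition submodular_theta_column)
       (simp_all add: theta_column_empty theta_column_UNIV)
  then show ?thesis using that by (auto simp: schubert_points_def theta_column_UNIV)
qed

text \<open>The sum of \<open>x j - y j\<close> over a down-set of rows ending at \<open>p\<close> vanishes unless \<open>p\<close> lies in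
  the movable interval of \<open>C j\<close> without its bottom row. These half-open intervals are disjoint.\<close>

lemma schubert_points_sum_unique:
  fixes x y :: "'k \<Rightarrow> 'n::{finite,linorder} \<Rightarrow> 'b::linordered_idom" and C :: "'k \<Rightarrow> 'n set"
  assumes K: "finite K"
    and M: "\<And>j k. j \<in> K \<Longrightarrow> k \<in> K \<Longrightarrow> j \<noteq> k \<Longrightarrow> card (movable_interval (C j) \<inter> movable_interval (C k)) \<le> 1"
    and x: "\<And>j. j \<in> K \<Longrightarrow> x j \<in> schubert_points t (C j)"
    and y: "\<And>j. j \<in> K \<Longrightarrow> y j \<in> schubert_points t (C j)"
    and eq: "\<And>i. (\<Sum>j\<in>K. x j i) = (\<Sum>j\<in>K. y j i)"
    and j: "j \<in> K"
  shows "x j = y j"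
proof -
  define z where "z j i = x j i - y j i" for j i
  have z0: "z j i = 0" if "j \<in> K" "i \<notin> movable_interval (C j)" for i j
    using that schubert_points_eq_outside_movable_interval[OF x[OF that(1)] that(2)]
      schubert_points_eq_outside_movable_interval[OF y[OF that(1)] that(2)] by (simp add: z_def)
  have zU: "sum (z j) UNIV = 0" if "j \<in> K" for j
    using schubert_points_sum_UNIV[OF x[OF that]] schubert_points_sum_UNIV[OF y[OF that]]
    by (simp add: z_def sum_subtractf)
  have half_open: "p \<in> movable_interval (C j) \<and> (\<exists>q\<in>movable_interval (C j). p < q)"
    if "j \<in> K" and nz: "sum (z j) {..p} \<noteq> 0" for j p
  proof -
    obtain i where i: "i \<le> p" "i \<in> movable_interval (C j)"
      using nz z0[OF \<open>j \<in> K\<close>] by (meson atMost_iff sum.neutral)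
    have "sum (z j) {..p} + sum (z j) {p<..} = sum (z j) ({..p} \<union> {p<..})"
      by (intro sum.union_disjoint[symmetric]) auto
    also have "{..p} \<union> {p<..} = UNIV" by auto
    finally have "sum (z j) {p<..} \<noteq> 0" using zU[OF \<open>j \<in> K\<close>] nz by auto
    then obtain q where q: "p < q" "q \<in> movable_interval (C j)"
      using z0[OF \<open>j \<in> K\<close>] by (meson greaterThan_iff sum.neutral)
    obtain a b where "movable_interval (C j) = {a..b}"
      using movable_interval_bounds[OF i(2)] by blast
    then show ?thesis using i q by auto
  qed
  have prefix: "sum (z j) {..p} = 0" if "j \<in> K" for j p
  proof (rule ccontr)
    assume nz: "sum (z j) {..p} \<noteq> 0"
    have "sum (z k) {..p} = 0" if k: "k \<in> K - {j}" for k
    proof (rule ccontr)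
      assume nzk: "sum (z k) {..p} \<noteq> 0"
      obtain q where q: "p \<in> movable_interval (C j)" "q \<in> movable_interval (C j)" "p < q"
        using half_open[OF \<open>j \<in> K\<close> nz] by blast
      obtain r where r: "p \<in> movable_interval (C k)" "r \<in> movable_interval (C k)" "p < r"
        using half_open[of k] k nzk by blast
      obtain a b c d where "movable_interval (C j) = {a..b}" "movable_interval (C k) = {c..d}"
        using movable_interval_bounds[OF q(1)] movable_interval_bounds[OF r(1)] by metis
      \<comment> \<open>The smaller of the two witnesses lies in both intervals and gives a second
        common row besides \<open>p\<close>.\<close>
      then have "{p, min q r} \<subseteq> movable_interval (C j) \<inter> movable_interval (C k)"
        using q r by (auto simp: min_def)
      then have "card {p, min q r} \<le> card (movable_interval (C j) \<inter> movable_interval (C k))"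
        by (intro card_mono) auto
      moreover have "card {p, min q r} = 2" using q(3) r(3) by (auto simp: min_def)
      ultimately show False using M[of j k] k \<open>j \<in> K\<close> by force
    qed
    \<comment> \<open>Only column \<open>j\<close> contributes at \<open>p\<close>, whereas by
      \<open>eq\<close> the prefix sums of all columns cancel.\<close>
    then have "(\<Sum>k\<in>K. sum (z k) {..p}) = sum (z j) {..p}"
      using sum.remove[OF K \<open>j \<in> K\<close>, of "\<lambda>k. sum (z k) {..p}"] by simp
    moreover have "(\<Sum>k\<in>K. sum (z k) {..p}) = (\<Sum>i\<in>{..p}. \<Sum>k\<in>K. z k i)"
      by (rule sum.swap)
    moreover have "\<dots> = 0" using eq by (simp add: z_def sum_subtractf)
    ultimately show False using nz by simp
  qed
  show ?thesis
  proof (rule ccontr)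
    assume "x j \<noteq> y j"
    then have ne: "{i. z j i \<noteq> 0} \<noteq> {}" by (auto simp: z_def)
    \<comment> \<open>At the first row where \<open>z j\<close> is nonzero, the prefix sum is that
      single entry.\<close>
    define p where "p = Min {i. z j i \<noteq> 0}"
    have "p \<in> {i. z j i \<noteq> 0}" unfolding p_def using ne by (intro Min_in) auto
    moreover have "z j i = 0" if "i < p" for i
      using that Min_le[of "{i. z j i \<noteq> 0}" i] unfolding p_def by (auto simp: not_less[symmetric])
    then have "sum (z j) {..p} = sum (z j) {p}"
      by (intro sum.mono_neutral_right) (auto simp: order_le_less)
    ultimately show False using prefix[OF j, of p] by simp
  qed
qed

section \<open>Lattice points of the Schubitope\<close>

abbreviation indicator_vec :: "'n::finite set \<Rightarrow> real ^ 'n::finite" where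
  "indicator_vec T \<equiv> (\<Sum>b\<in>T. axis b 1)"

lemma indicator_vec_nth: "indicator_vec T $ i = of_bool (i \<in> T)"
  by (simp add: axis_def sum.delta' flip: of_bool_def)

lemma indicator_vec_in_lattice_points: "indicator_vec T \<in> lattice_points"
  unfolding lattice_points_def mem_Collect_eq indicator_vec_nth by simp

lemma sum_in_lattice_points:
  "(\<And>k. k \<in> K \<Longrightarrow> x k \<in> lattice_points) \<Longrightarrow> (\<Sum>k\<in>K. x k) \<in> lattice_points"
  by (auto simp: lattice_points_def intro: Ints_sum)

lemma lattice_points_of_int:
  assumes "x \<in> lattice_points"
  obtains \<alpha> :: "'n::finite \<Rightarrow> int" where "\<And>i. x $ i = of_int (\<alpha> i)"
proof -
  have "\<exists>m. x $ i = of_int m" for i using assms by (auto simp: lattice_points_def elim: Ints_cases)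
  then show ?thesis using that by metis
qed

abbreviation schubert_polytope :: "'n::{finite,linorder} set \<Rightarrow> (real ^ 'n::{finite,linorder}) set" where
  "schubert_polytope C \<equiv> base_polytope (schubert_matroid_bases C)"

lemma convex_schubert_points: "convex {x :: real ^ 'n::{finite,linorder}. vec_nth x \<in> schubert_points t C}"
  unfolding convex_alt
proof (intro ballI allI impI, elim conjE)
  fix x y :: "real ^ 'n::{finite,linorder}" and u :: real
  assume x: "x \<in> {x. vec_nth x \<in> schubert_points t C}" and y: "y \<in> {x. vec_nth x \<in> schubert_points t C}"
    and u: "0 \<le> u" "u \<le> 1"
  let ?z = "(1 - u) *\<^sub>R x + u *\<^sub>R y"
  have sum: "sum (vec_nth ?z) I = (1 - u) * sum (vec_nth x) I + u * sum (vec_nth y) I" for I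
    by (simp add: sum.distrib sum_distrib_left)
  have "sum (vec_nth ?z) I \<le> real (t * theta_column C I)" for I
  proof -
    have "sum (vec_nth ?z) I \<le> (1 - u) * real (t * theta_column C I) + u * real (t * theta_column C I)"
      unfolding sum using x y u
      by (intro add_mono mult_left_mono) (auto simp: schubert_points_def)
    then show ?thesis by (simp add: algebra_simps)
  qed
  moreover have "sum (vec_nth ?z) UNIV = real (t * card C)"
    unfolding sum using x y by (simp add: schubert_points_def algebra_simps)
  ultimately show "?z \<in> {x. vec_nth x \<in> schubert_points t C}" by (simp add: schubert_points_def)
qed

lemma schubert_polytope_subset:
  fixes C :: "'n::{finite,linorder} set"
  assumes "x \<in> schubert_polytope C"
  shows "vec_nth x \<in> schubert_points 1 C"
proof -
  have "indicator_vec T \<in> {x :: real ^ 'n::{finite,linorder}. vec_nth x \<in> schubert_points 1 C}" if "gale_le T C" for T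
  proof -
    have "vec_nth (indicator_vec T :: real ^ 'n::{finite,linorder}) = (\<lambda>i. of_bool (i \<in> T))"
      by (intro ext indicator_vec_nth)
    then show ?thesis using of_bool_in_schubert_points[OF that] by auto
  qed
  then have "schubert_polytope C \<subseteq> {x. vec_nth x \<in> schubert_points 1 C}"
    unfolding base_polytope_def schubert_matroid_bases_def
    by (intro hull_minimal convex_schubert_points) auto
  then show ?thesis using assms by blast
qed

lemma scaled_schubert_polytope_subset:
  assumes "x \<in> (*\<^sub>R) (real t) ` schubert_polytope C"
  shows "vec_nth x \<in> schubert_points t C"
proof -
  obtain y where y: "x = real t *\<^sub>R y" "y \<in> schubert_polytope C" using assms by blast
  have sum: "sum (vec_nth x) I = real t * sum (vec_nth y) I" for I
    unfolding y(1) by (simp add: sum_distrib_left)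
  have "vec_nth y \<in> schubert_points 1 C" using y(2) by (rule schubert_polytope_subset)
  then show ?thesis unfolding schubert_points_def sum
    by (simp add: sum mult_left_mono)
qed

lemma schubert_polytope_nonempty: "schubert_polytope C \<noteq> {}"
  unfolding base_polytope_def schubert_matroid_bases_def using gale_le_refl[of C] by auto

text \<open>For positive \<open>t\<close> the sum is \<open>t\<close> times the average of
  \<open>t\<close> vertices. For \<open>t = 0\<close> it is the origin, which lies in the dilate
  because the polytope is nonempty.\<close>

lemma sum_indicator_vec_in_scaled_schubert_polytope:
  fixes C :: "'n::{finite,linorder} set"
  assumes "\<And>k. k < t \<Longrightarrow> gale_le (T k) C"
  shows "(\<Sum>k<t. indicator_vec (T k)) \<in> (*\<^sub>R) (real t) ` schubert_polytope C"
proof (cases "t = 0")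
  case True
  then show ?thesis using schubert_polytope_nonempty[of C] by auto
next
  case False
  have "(\<Sum>k<t. (1 / real t) *\<^sub>R indicator_vec (T k)) \<in> schubert_polytope C"
    using assms False unfolding base_polytope_def schubert_matroid_bases_def
    by (intro convex_sum convex_convex_hull) (auto intro!: hull_inc)
  moreover have "(\<Sum>k<t. indicator_vec (T k))
      = real t *\<^sub>R (\<Sum>k<t. (1 / real t) *\<^sub>R indicator_vec (T k) :: real ^ 'n::{finite,linorder})"
    using False by (simp only: scaleR_sum_right scaleR_scaleR) simp
  ultimately show ?thesis by blast
qed

lemma sum_vec_nth_sum:
  "sum (vec_nth (\<Sum>j\<in>K. x j)) I = (\<Sum>j\<in>K. sum (vec_nth (x j)) I)"
  unfolding sum_component by (rule sum.swap)

lemma sum_in_scaled_schubitope: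
  fixes D :: "'n::{finite,linorder} diagram" and x :: "'n \<Rightarrow> real ^ 'n::{finite,linorder}"
  assumes "\<And>j. vec_nth (x j) \<in> schubert_points t (D j)" "0 < t"
  shows "(\<Sum>j\<in>UNIV. x j) \<in> (*\<^sub>R) (real t) ` schubitope D"
proof -
  define s where "s = (\<Sum>j\<in>UNIV. x j)"
  define y where "y = (1 / real t) *\<^sub>R s"
  have sum_y: "sum (vec_nth y) I = sum (vec_nth s) I / real t" for I
    unfolding y_def by (simp add: sum_divide_distrib)
  have "0 \<le> y $ i" for i
  proof -
    have "0 \<le> s $ i" unfolding s_def sum_component
      by (intro sum_nonneg schubert_points_nonneg[OF assms(1)])
    then show ?thesis by (simp add: y_def)
  qed
  moreover have "sum (vec_nth s) UNIV = real t * real (num_boxes D)"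
    unfolding s_def sum_vec_nth_sum
    by (simp add: schubert_points_sum_UNIV[OF assms(1)] num_boxes_def sum_distrib_left)
  then have "sum (vec_nth y) UNIV = real (num_boxes D)" using assms(2) sum_y[of UNIV] by simp
  moreover have "sum (vec_nth s) I \<le> real t * real (theta D I)" for I
  proof -
    have "sum (vec_nth s) I \<le> (\<Sum>j\<in>UNIV. real (t * theta_column (D j) I))"
      unfolding s_def sum_vec_nth_sum by (intro sum_mono schubert_points_sum_le[OF assms(1)])
    then show ?thesis by (simp add: theta_def sum_distrib_left)
  qed
  then have "sum (vec_nth y) I \<le> real (theta D I)" for I
    using assms(2) sum_y[of I] by (simp add: divide_le_eq mult.commute)
  ultimately have "y \<in> schubitope D" by (simp add: schubitope_def)
  moreover have "s = real t *\<^sub>R y" using assms(2) by (simp add: y_def)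
  ultimately show ?thesis unfolding s_def by blast
qed

lemma sum_in_schubitope:
  fixes D :: "'n::{finite,linorder} diagram" and x :: "'n \<Rightarrow> real ^ 'n::{finite,linorder}"
  assumes "\<And>j. vec_nth (x j) \<in> schubert_points 1 (D j)"
  shows "(\<Sum>j\<in>UNIV. x j) \<in> schubitope D"
  using sum_in_scaled_schubitope[of x 1 D] assms by simp

lemma sum_indicator_vec_in_schubitope:
  fixes D :: "'n::{finite,linorder} diagram"
  assumes "\<And>j. gale_le (T j) (D j)"
  shows "(\<Sum>j\<in>UNIV. indicator_vec (T j)) \<in> schubitope D"
proof (rule sum_in_schubitope)
  fix j
  have "(\<Sum>k<(1::nat). indicator_vec (T j)) \<in> (*\<^sub>R) (real 1) ` schubert_polytope (D j)"
    by (intro sum_indicator_vec_in_scaled_schubert_polytope assms)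
  then show "vec_nth (indicator_vec (T j)) \<in> schubert_points 1 (D j)"
    using schubert_polytope_subset[of "indicator_vec (T j)" "D j"] by simp
qed

lemma schubitope_decomposition:
  assumes "x \<in> schubitope D"
  obtains y where "\<And>j. vec_nth (y j) \<in> schubert_points 1 (D j)" "x = (\<Sum>j\<in>UNIV. y j)"
proof -
  obtain z where z: "\<And>j. z j \<in> schubert_points 1 (D j)" "\<And>i. x $ i = (\<Sum>j\<in>UNIV. z j i)"
    using schubert_points_decomposition[of UNIV "vec_nth x" D] assms
    by (auto simp: schubitope_def theta_def num_boxes_def)
  show ?thesis
  proof (rule that)
    show "vec_nth (\<chi> i. z j i) \<in> schubert_points 1 (D j)" for j
    proof -
      have "vec_nth (\<chi> i. z j i) = z j" by (rule ext) simp
      then show ?thesis using z(1) by simp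
    qed
    show "x = (\<Sum>j\<in>UNIV. \<chi> i. z j i)" by (simp add: vec_eq_iff z(2))
  qed
qed

text \<open>The integer decomposition property. With each column repeated \<open>t\<close> times,
  the decomposition over \<open>int\<close> produces integral points of undilated Schubert matroid
  polytopes, and these are indicators of bases.\<close>

lemma scaled_schubitope_lattice_point_decomposition:
  fixes D :: "'n::{finite,linorder} diagram"
  assumes x: "x \<in> (*\<^sub>R) (real t) ` schubitope D" "x \<in> lattice_points"
  obtains T where "\<And>j k. k < t \<Longrightarrow> gale_le (T j k) (D j)"
    "x = (\<Sum>j\<in>UNIV. \<Sum>k<t. indicator_vec (T j k))"
proof -
  obtain \<alpha> :: "'n \<Rightarrow> int" where \<alpha>: "\<And>i. x $ i = of_int (\<alpha> i)"
    using lattice_points_of_int[OF x(2)] by blast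
  obtain y where y: "x = real t *\<^sub>R y" "y \<in> schubitope D" using x(1) by blast
  have sum: "of_int (sum \<alpha> I) = real t * sum (vec_nth y) I" for I
  proof -
    have "of_int (sum \<alpha> I) = sum (vec_nth x) I" by (simp add: \<alpha>)
    then show ?thesis unfolding y(1) by (simp add: sum_distrib_left)
  qed
  let ?K = "(UNIV :: 'n set) \<times> {..<t}"
  have prod: "(\<Sum>k\<in>?K. int (f (fst k))) = int t * (\<Sum>j\<in>UNIV. int (f j))" for f :: "'n \<Rightarrow> nat"
    by (simp add: sum.cartesian_product' sum_distrib_left)
  have "sum \<alpha> I \<le> (\<Sum>k\<in>?K. of_nat (theta_column (D (fst k)) I))" for I
  proof -
    have "real t * sum (vec_nth y) I \<le> real t * real (theta D I)"
      using y(2) by (intro mult_left_mono) (auto simp: schubitope_def)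
    then have "real_of_int (sum \<alpha> I) \<le> real_of_int (int t * int (theta D I))"
      unfolding sum by simp
    then show ?thesis
      using prod[of "\<lambda>j. theta_column (D j) I"] unfolding of_int_le_iff by (simp add: theta_def)
  qed
  moreover have "sum \<alpha> UNIV = (\<Sum>k\<in>?K. of_nat (card (D (fst k))))"
  proof -
    have "real_of_int (sum \<alpha> UNIV) = real_of_int (int t * int (num_boxes D))"
      unfolding sum using y(2) by (simp add: schubitope_def)
    then show ?thesis
      using prod[of "\<lambda>j. card (D j)"] unfolding of_int_eq_iff by (simp add: num_boxes_def)
  qed
  ultimately obtain z where z: "\<And>k. k \<in> ?K \<Longrightarrow> z k \<in> schubert_points 1 (D (fst k))"
    "\<And>i. \<alpha> i = (\<Sum>k\<in>?K. z k i)"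
    using schubert_points_decomposition[of ?K \<alpha> "\<lambda>k. D (fst k)"] by auto
  have "\<forall>j k. k < t \<longrightarrow> (\<exists>T. gale_le T (D j) \<and> z (j, k) = (\<lambda>i. of_bool (i \<in> T)))"
    using int_schubert_points_1 z(1) by (metis UNIV_I fst_conv lessThan_iff mem_Sigma_iff)
  then obtain T where T: "\<And>j k. k < t \<Longrightarrow> gale_le (T j k) (D j) \<and> z (j, k) = (\<lambda>i. of_bool (i \<in> T j k))"
    by metis
  have double_sum_nth: "(\<Sum>j\<in>UNIV. \<Sum>k<t. v j k) $ i = (\<Sum>j\<in>UNIV. \<Sum>k<t. v j k $ i)"
    for v :: "'n \<Rightarrow> nat \<Rightarrow> real ^ 'n::{finite,linorder}" and i
    by simp
  have "x $ i = (\<Sum>j\<in>UNIV. \<Sum>k<t. indicator_vec (T j k)) $ i" for i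
  proof -
    have "\<alpha> i = (\<Sum>j\<in>UNIV. \<Sum>k<t. z (j, k) i)"
      unfolding z(2) by (simp add: sum.cartesian_product)
    also have "\<dots> = (\<Sum>j\<in>UNIV. \<Sum>k<t. of_bool (i \<in> T j k))"
      using T by (intro sum.cong) auto
    finally show ?thesis
      unfolding \<alpha> double_sum_nth[of "\<lambda>j k. indicator_vec (T j k)"] indicator_vec_nth by simp
  qed
  then show ?thesis using that T by (metis vec_eq_iff)
qed

lemma schubitope_nonempty: "schubitope D \<noteq> {}"
  using sum_indicator_vec_in_schubitope[of D D] gale_le_refl by blast

section \<open>Ehrhart counts and the product formula\<close>

lemma ehrhart_0:
  assumes "P \<noteq> {}"
  shows "ehrhart P 0 = 1"
proof -
  have "(*\<^sub>R) (real 0) ` P \<inter> lattice_points = {0}"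
    using assms by (auto simp: lattice_points_def)
  then show ?thesis using assms by (simp add: ehrhart_def)
qed

definition dilate_lattice :: "nat \<Rightarrow> 'n::{finite,linorder} diagram \<Rightarrow> 'n \<Rightarrow> (real ^ 'n::{finite,linorder}) set" where
  "dilate_lattice t D j = (*\<^sub>R) (real t) ` schubert_polytope (D j) \<inter> lattice_points"

text \<open>To reach every lattice point, the \<open>t\<close> bases that the integral decomposition
  assigns to a column are added up within that column.\<close>

lemma sum_dilate_lattice_image:
  fixes D :: "'n::{finite,linorder} diagram"
  assumes "0 < t"
  shows "(\<lambda>x. \<Sum>j\<in>UNIV. x j) ` (\<Pi>\<^sub>E j\<in>UNIV. dilate_lattice t D j)
         = (*\<^sub>R) (real t) ` schubitope D \<inter> lattice_points" (is "?L = ?R")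
proof (intro equalityI subsetI)
  fix s assume "s \<in> ?L"
  then obtain x where x: "\<And>j. x j \<in> dilate_lattice t D j" "s = (\<Sum>j\<in>UNIV. x j)"
    by (auto simp: PiE_UNIV_domain Pi_iff)
  have "x j \<in> (*\<^sub>R) (real t) ` schubert_polytope (D j)" "x j \<in> lattice_points" for j
    using x(1)[of j] unfolding dilate_lattice_def by blast+
  then show "s \<in> ?R"
    unfolding x(2) by (intro IntI sum_in_scaled_schubitope sum_in_lattice_points
        scaled_schubert_polytope_subset assms)
next
  fix s assume "s \<in> ?R"
  then obtain T where T: "\<And>j k. k < t \<Longrightarrow> gale_le (T j k) (D j)"
    "s = (\<Sum>j\<in>UNIV. \<Sum>k<t. indicator_vec (T j k))"
    using scaled_schubitope_lattice_point_decomposition[of s t D] by blast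
  have "(\<Sum>k<t. indicator_vec (T j k)) \<in> dilate_lattice t D j" for j
    unfolding dilate_lattice_def
    using T(1) by (intro IntI sum_indicator_vec_in_scaled_schubert_polytope sum_in_lattice_points
        indicator_vec_in_lattice_points)
  then have "(\<lambda>j. \<Sum>k<t. indicator_vec (T j k)) \<in> (\<Pi>\<^sub>E j\<in>UNIV. dilate_lattice t D j)"
    unfolding PiE_UNIV_domain Pi_iff by blast
  then show "s \<in> ?L" unfolding T(2) by (rule image_eqI[OF refl])
qed

text \<open>Together with \<open>prod_ehrhart\<close> this turns the product formula at
  \<open>t\<close> into the equality of the cardinalities of a product set and of its image under
  addition. For finite sets that equality means that addition is injective.\<close>

lemma ehrhart_schubitope:
  assumes "0 < t"
  shows "ehrhart (schubitope D) t
    = card ((\<lambda>x. \<Sum>j\<in>UNIV. x j) ` (\<Pi>\<^sub>E j\<in>UNIV. dilate_lattice t D j))"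
  unfolding sum_dilate_lattice_image[OF assms] by (simp add: ehrhart_def schubitope_nonempty)

lemma prod_ehrhart:
  "(\<Prod>j\<in>UNIV. ehrhart (schubert_polytope (D j)) t) = card (\<Pi>\<^sub>E j\<in>UNIV. dilate_lattice t D j)"
  by (subst card_PiE) (simp_all add: ehrhart_def schubert_polytope_nonempty dilate_lattice_def)

abbreviation movable_disjoint :: "'n::{finite,linorder} diagram \<Rightarrow> bool" where
  "movable_disjoint D \<equiv> (\<forall>i j. i < j \<longrightarrow> card (movable_interval (D i) \<inter> movable_interval (D j)) \<le> 1)"

lemma movable_disjoint_unique:
  fixes D :: "'n::{finite,linorder} diagram" and x y :: "'n \<Rightarrow> real ^ 'n::{finite,linorder}"
  assumes "movable_disjoint D"
    and "\<And>j. vec_nth (x j) \<in> schubert_points t (D j)" "\<And>j. vec_nth (y j) \<in> schubert_points t (D j)"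
    and eq: "(\<Sum>j\<in>UNIV. x j) = (\<Sum>j\<in>UNIV. y j)"
  shows "x = y"
proof
  fix j
  have "vec_nth (x j) = vec_nth (y j)"
  proof (rule schubert_points_sum_unique[where K = UNIV and C = D and x = "\<lambda>j. vec_nth (x j)"])
    show "card (movable_interval (D j) \<inter> movable_interval (D k)) \<le> 1" if "j \<noteq> k" for j k
      using assms(1) that by (metis Int_commute neq_iff)
    show "(\<Sum>j\<in>UNIV. x j $ i) = (\<Sum>j\<in>UNIV. y j $ i)" for i
      using eq by (metis sum_component)
  qed (use assms in auto)
  then show "x j = y j" by (simp add: vec_nth_inject)
qed

lemma movable_disjoint_ehrhart:
  assumes "movable_disjoint D"
  shows "ehrhart (schubitope D) t = (\<Prod>j\<in>UNIV. ehrhart (schubert_polytope (D j)) t)"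
proof (cases "t = 0")
  case True
  then show ?thesis by (simp add: ehrhart_0 schubitope_nonempty schubert_polytope_nonempty)
next
  case False
  have "inj_on (\<lambda>x. \<Sum>j\<in>UNIV. x j) (\<Pi>\<^sub>E j\<in>UNIV. dilate_lattice t D j)"
  proof (rule inj_onI)
    fix x y assume *: "x \<in> (\<Pi>\<^sub>E j\<in>UNIV. dilate_lattice t D j)" "y \<in> (\<Pi>\<^sub>E j\<in>UNIV. dilate_lattice t D j)"
      "(\<Sum>j\<in>UNIV. x j) = (\<Sum>j\<in>UNIV. y j)"
    have "vec_nth (z j) \<in> schubert_points t (D j)" if "z \<in> (\<Pi>\<^sub>E j\<in>UNIV. dilate_lattice t D j)" for z j
      using that
      by (intro scaled_schubert_polytope_subset) (simp add: dilate_lattice_def PiE_UNIV_domain Pi_iff)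
    then show "x = y" using * movable_disjoint_unique[OF assms] by blast
  qed
  then show ?thesis using False by (simp add: ehrhart_schubitope prod_ehrhart card_image)
qed

text \<open>Integral points with entries between 0 and 1 are indicators of sets of rows. Finiteness
  makes it possible to infer injectivity from equal cardinalities.\<close>

lemma finite_dilate_lattice_1:
  fixes D :: "'n::{finite,linorder} diagram"
  shows "finite (dilate_lattice 1 D j)"
proof (rule finite_subset)
  show "dilate_lattice 1 D j \<subseteq> range (\<lambda>T. indicator_vec T)"
  proof
    fix x assume "x \<in> dilate_lattice 1 D j"
    then have x: "vec_nth x \<in> schubert_points 1 (D j)" "x \<in> lattice_points"
      using scaled_schubert_polytope_subset[of x 1 "D j"] by (auto simp: dilate_lattice_def)
    obtain \<alpha> where \<alpha>: "\<And>i. x $ i = of_int (\<alpha> i)" using lattice_points_of_int[OF x(2)] by blast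
    have "x $ i = of_bool (i \<in> {i. x $ i = 1})" for i
      using schubert_points_nonneg[OF x(1), of i] schubert_points_le[OF x(1), of i]
      by (auto simp: \<alpha>)
    then have "x = indicator_vec {i. x $ i = 1}" unfolding vec_eq_iff indicator_vec_nth by blast
    then show "x \<in> range (\<lambda>T. indicator_vec T)" by blast
  qed
qed simp

section \<open>Two movable intervals with two common rows\<close>

lemma in_open_segment_minus_plus:
  fixes x d :: "'a::real_vector"
  assumes "d \<noteq> 0"
  shows "x \<in> open_segment (x - d) (x + d)"
proof -
  have "midpoint (x - d) (x + d) = x" by (simp add: midpoint_eq_iff scaleR_2)
  moreover have "x - d \<noteq> x + d"
  proof
    assume "x - d = x + d"
    then have "2 *\<^sub>R d = 0" by (simp add: scaleR_2 algebra_simps)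
    then show False using assms by simp
  qed
  ultimately show ?thesis using midpoint_in_open_segment[of "x - d" "x + d"] by simp
qed

lemma not_movable_disjoint_exchange:
  fixes D :: "'n::{finite,linorder} diagram"
  assumes "\<not> movable_disjoint D"
  obtains i j p q A B where "i \<noteq> j" "p \<noteq> q"
    "gale_le A (D i)" "q \<in> A" "p \<notin> A" "gale_le (insert p (A - {q})) (D i)"
    "gale_le B (D j)" "q \<in> B" "p \<notin> B" "gale_le (insert p (B - {q})) (D j)"
proof -
  note exchange = that
  obtain i j where ij: "i < j" "\<not> card (movable_interval (D i) \<inter> movable_interval (D j)) \<le> 1"
    using assms by blast
  then obtain p q where pq: "p \<in> movable_interval (D i)" "p \<in> movable_interval (D j)"
    "q \<in> movable_interval (D i)" "q \<in> movable_interval (D j)" "p \<noteq> q"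
    using card_le_Suc0_iff_eq[of "movable_interval (D i) \<inter> movable_interval (D j)"] by auto
  have *: thesis if p: "p \<in> movable_interval (D i)" "p \<in> movable_interval (D j)"
    and q: "q \<in> movable_interval (D i)" "q \<in> movable_interval (D j)" and less: "p < q" for p q
  proof -
    obtain A where A: "gale_le A (D i)" "q \<in> A" "p \<notin> A"
      using movable_interval_exchange[OF p(1) q(1) less] .
    obtain B where B: "gale_le B (D j)" "q \<in> B" "p \<notin> B"
      using movable_interval_exchange[OF p(2) q(2) less] .
    show thesis
      using exchange[of i j p q A B] ij(1) less A B gale_le_exchange[OF A less] gale_le_exchange[OF B less]
      by auto
  qed
  show thesis using *[of p q] *[of q p] pq by (meson linorder_neqE)
qed

lemma indicator_vec_exchange:
  assumes "q \<in> A" "p \<notin> A"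
  shows "indicator_vec (insert p (A - {q})) = indicator_vec A + (axis p 1 - axis q 1 :: real ^ 'n::finite)"
  using assms by (simp add: sum.remove[of A q])

lemma sum_indicator_vec_fun_upd2:
  fixes D :: "'n::finite diagram"
  assumes "i \<noteq> j"
  shows "(\<Sum>k\<in>UNIV. indicator_vec ((D(i := A, j := B)) k)) =
     indicator_vec A + indicator_vec B + (\<Sum>k\<in>UNIV - {i} - {j}. indicator_vec (D k))"
proof -
  let ?F = "D(i := A, j := B)"
  have "(\<Sum>k\<in>UNIV. indicator_vec (?F k)) =
    indicator_vec (?F i) + (indicator_vec (?F j) + (\<Sum>k\<in>UNIV - {i} - {j}. indicator_vec (?F k)))"
    using assms sum.remove[of UNIV i "\<lambda>k. indicator_vec (?F k)"]
      sum.remove[of "UNIV - {i}" j "\<lambda>k. indicator_vec (?F k)"] by (simp only: finite UNIV_I) auto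
  also have "(\<Sum>k\<in>UNIV - {i} - {j}. indicator_vec (?F k)) =
    (\<Sum>k\<in>UNIV - {i} - {j}. indicator_vec (D k) :: real ^ 'n)"
    by (intro sum.cong) auto
  finally have "(\<Sum>k\<in>UNIV. indicator_vec (?F k)) = indicator_vec (?F i) +
    (indicator_vec (?F j) + (\<Sum>k\<in>UNIV - {i} - {j}. indicator_vec (D k) :: real ^ 'n))" .
  moreover have "?F i = A" "?F j = B" using assms by simp_all
  ultimately show ?thesis by (simp only: add.assoc)
qed

text \<open>The exchange of \<open>q\<close> for \<open>p\<close> can be made in neither, one or
  both of the columns \<open>i\<close> and \<open>j\<close>. This gives three points
  \<open>v\<close>, \<open>v + e\<close>, \<open>v + e + e\<close> of the Schubitope, and the middle
  one is a lattice point but not extreme.\<close>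

lemma not_movable_disjoint_not_lattice_free:
  fixes D :: "'n::{finite,linorder} diagram"
  assumes "\<not> movable_disjoint D"
  shows "\<not> lattice_free (schubitope D)"
proof -
  obtain i j p q A B where *: "i \<noteq> j" "p \<noteq> q"
    and A: "gale_le A (D i)" "q \<in> A" "p \<notin> A" "gale_le (insert p (A - {q})) (D i)"
    and B: "gale_le B (D j)" "q \<in> B" "p \<notin> B" "gale_le (insert p (B - {q})) (D j)"
    using not_movable_disjoint_exchange[OF assms] .
  define R where "R = (\<Sum>k\<in>UNIV - {i} - {j}. indicator_vec (D k))"
  define e :: "real ^ 'n::{finite,linorder}" where "e = axis p 1 - axis q 1"
  define v where "v = indicator_vec A + indicator_vec B + R"
  have mem: "indicator_vec X + indicator_vec Y + R \<in> schubitope D"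
    if "gale_le X (D i)" "gale_le Y (D j)" for X Y
  proof -
    have "(\<Sum>k\<in>UNIV. indicator_vec ((D(i := X, j := Y)) k)) \<in> schubitope D"
      using that by (intro sum_indicator_vec_in_schubitope) (simp add: gale_le_refl)
    then show ?thesis unfolding sum_indicator_vec_fun_upd2[OF *(1)] R_def .
  qed
  have v: "v \<in> schubitope D" "v + e \<in> schubitope D" "v + e + e \<in> schubitope D"
    using mem[OF A(1) B(1)] mem[OF A(4) B(1)] mem[OF A(4) B(4)]
    unfolding indicator_vec_exchange[OF A(2,3)] indicator_vec_exchange[OF B(2,3)] v_def e_def
    by (simp_all only: ac_simps)
  have "e $ p = 1" using *(2) by (simp add: e_def axis_def)
  then have "e \<noteq> 0" by auto
  then have "v + e \<in> open_segment (v + e - e) (v + e + e)"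
    by (rule in_open_segment_minus_plus)
  then have "\<not> (v + e) extreme_point_of (schubitope D)"
    using v unfolding extreme_point_of_def add_diff_cancel_right' by blast
  moreover have "v + e \<in> lattice_points"
  proof -
    have "v + e = (\<Sum>k\<in>UNIV. indicator_vec ((D(i := insert p (A - {q}), j := B)) k))"
      unfolding sum_indicator_vec_fun_upd2[OF *(1)] indicator_vec_exchange[OF A(2,3)]
        v_def e_def R_def by (simp only: ac_simps)
    then show ?thesis by (simp only: sum_in_lattice_points indicator_vec_in_lattice_points)
  qed
  ultimately show ?thesis using v(2) unfolding lattice_free_def by blast
qed

text \<open>Exchanging in column \<open>i\<close> or in column \<open>j\<close> gives two different
  tuples with the same sum, so addition is not injective at \<open>t = 1\<close>.\<close>

lemma not_movable_disjoint_ehrhart: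
  fixes D :: "'n::{finite,linorder} diagram"
  assumes "\<not> movable_disjoint D"
  shows "ehrhart (schubitope D) 1 \<noteq> (\<Prod>j\<in>UNIV. ehrhart (schubert_polytope (D j)) 1)"
proof
  assume eq: "ehrhart (schubitope D) 1 = (\<Prod>j\<in>UNIV. ehrhart (schubert_polytope (D j)) 1)"
  let ?X = "\<Pi>\<^sub>E j\<in>UNIV. dilate_lattice 1 D j"
  have "inj_on (\<lambda>x. \<Sum>j\<in>UNIV. x j) ?X"
    using eq unfolding ehrhart_schubitope[OF zero_less_one] prod_ehrhart
    by (intro eq_card_imp_inj_on finite_PiE finite_dilate_lattice_1) auto
  obtain i j p q A B where *: "i \<noteq> j" "p \<noteq> q"
    and A: "gale_le A (D i)" "q \<in> A" "p \<notin> A" "gale_le (insert p (A - {q})) (D i)"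
    and B: "gale_le B (D j)" "q \<in> B" "p \<notin> B" "gale_le (insert p (B - {q})) (D j)"
    using not_movable_disjoint_exchange[OF assms] .
  define f where "f X Y = (\<lambda>k. indicator_vec ((D(i := X, j := Y)) k) :: real ^ 'n::{finite,linorder})" for X Y
  have mem: "f X Y \<in> ?X" if "gale_le X (D i)" "gale_le Y (D j)" for X Y
  proof -
    have "indicator_vec T \<in> dilate_lattice 1 D k" if "gale_le T (D k)" for T k
      using sum_indicator_vec_in_scaled_schubert_polytope[of 1 "\<lambda>_. T" "D k"] that
        indicator_vec_in_lattice_points[of T] by (auto simp: dilate_lattice_def)
    then show ?thesis using that unfolding f_def by (simp add: PiE_UNIV_domain Pi_iff gale_le_refl)
  qed
  have "(\<Sum>k\<in>UNIV. f (insert p (A - {q})) B k) = (\<Sum>k\<in>UNIV. f A (insert p (B - {q})) k)"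
    unfolding f_def sum_indicator_vec_fun_upd2[OF *(1)]
      indicator_vec_exchange[OF A(2,3)] indicator_vec_exchange[OF B(2,3)] by (simp only: ac_simps)
  then have "f (insert p (A - {q})) B = f A (insert p (B - {q}))"
    by (rule inj_onD[OF \<open>inj_on _ ?X\<close> _ mem[OF A(4) B(1)] mem[OF A(1) B(4)]])
  \<comment> \<open>Column \<open>i\<close> of the two tuples is compared at row \<open>p\<close>,
    where the entries are 1 and 0.\<close>
  then have "indicator_vec (insert p (A - {q})) $ p = (indicator_vec A $ p :: real)"
    using *(1) unfolding f_def fun_eq_iff by (metis fun_upd_other fun_upd_same)
  then show False using A(3) unfolding indicator_vec_nth by simp
qed

section \<open>Extreme points of the Schubitope\<close>

lemma theta_submodular: "theta D (I \<union> J) + theta D (I \<inter> J) \<le> theta D I + theta D J"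
proof -
  have "theta_column C (I \<union> J) + theta_column C (I \<inter> J) \<le> theta_column C I + theta_column C J" for C
    using submodular_onD[OF submodular_theta_column[where 'b = int], of I J C]
    by (simp flip: of_nat_add)
  then show ?thesis unfolding theta_def by (simp add: sum_mono flip: sum.distrib)
qed

text \<open>Tight sets are closed under union and intersection. At a non-integral point there are two
  non-integral coordinates not separated by any tight set, and one can be raised at the expense of
  the other by a small amount, in either direction.\<close>

lemma extreme_point_schubitope_in_lattice_points:
  fixes D :: "'n::{finite,linorder} diagram"
  assumes "x extreme_point_of (schubitope D)"
  shows "x \<in> lattice_points"
proof (rule ccontr)
  assume "x \<notin> lattice_points"
  then have ex: "\<exists>e. x $ e \<notin> \<int>" by (simp add: lattice_points_def)
  have x: "x \<in> schubitope D" using assms by (simp add: extreme_point_of_def)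
  have x_nonneg: "0 \<le> x $ i" and x_UNIV: "sum (vec_nth x) UNIV = real (num_boxes D)"
    and x_le: "sum (vec_nth x) I \<le> real (theta D I)" for i I
    using x by (simp_all add: schubitope_def)
  define tight where "tight I \<longleftrightarrow> sum (vec_nth x) I = real (theta D I)" for I
  have tight_UNIV: "tight UNIV"
    using x_UNIV by (simp add: tight_def theta_def theta_column_UNIV num_boxes_def)
  have tight_Int: "tight (I \<inter> J)" if "tight I" "tight J" for I J
  proof -
    have "sum (vec_nth x) (I \<union> J) + sum (vec_nth x) (I \<inter> J) = sum (vec_nth x) I + sum (vec_nth x) J"
      by (rule sum.union_inter) auto
    moreover have "real (theta D (I \<union> J)) + real (theta D (I \<inter> J)) \<le> real (theta D I) + real (theta D J)"
      using theta_submodular[of D I J] by linarith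
    ultimately show ?thesis
      using that x_le[of "I \<union> J"] x_le[of "I \<inter> J"] unfolding tight_def by linarith
  qed
  define H where "H e = \<Inter>{I. tight I \<and> e \<in> I}" for e
  have tight_H: "tight (H e)" for e
  proof -
    \<comment> \<open>The empty intersection is \<open>UNIV\<close>, which is tight.\<close>
    have "tight (\<Inter>\<I>)" if "\<And>I. I \<in> \<I> \<Longrightarrow> tight I" for \<I> :: "'n set set"
      using finite[of \<I>] that
      by (induction \<I> rule: finite_induct) (auto simp: tight_UNIV intro!: tight_Int)
    from this[of "{I. tight I \<and> e \<in> I}"] show ?thesis unfolding H_def by blast
  qed
  have H_self: "e \<in> H e" for e by (simp add: H_def)
  have H_least: "H e \<subseteq> I" if "tight I" "e \<in> I" for e I using that by (auto simp: H_def)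
  \<comment> \<open>Minimality of \<open>H e\<close>, the smallest tight set containing
    \<open>e\<close>, will force \<open>H e' = H e\<close> for every other non-integral coordinate
    \<open>e'\<close> in it.\<close>
  obtain e where e: "x $ e \<notin> \<int>" and e_min: "\<And>e'. x $ e' \<notin> \<int> \<Longrightarrow> card (H e) \<le> card (H e')"
    using ex_has_least_nat[of "\<lambda>e. x $ e \<notin> \<int>" _ "\<lambda>e. card (H e)"] ex by metis
  have "\<exists>e'\<in>H e. e' \<noteq> e \<and> x $ e' \<notin> \<int>"
  proof (rule ccontr)
    assume "\<not> ?thesis"
    \<comment> \<open>The sum over a tight set is an integer, so it cannot have exactly one
      non-integral term.\<close>
    then have "sum (vec_nth x) (H e - {e}) \<in> \<int>" by (intro Ints_sum) auto
    moreover have "sum (vec_nth x) (H e) = x $ e + sum (vec_nth x) (H e - {e})"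
      using H_self by (intro sum.remove) auto
    moreover have "sum (vec_nth x) (H e) \<in> \<int>" using tight_H by (simp add: tight_def)
    ultimately show False using e by (metis Ints_diff add_diff_cancel_right')
  qed
  then obtain e' where e': "e' \<in> H e" "e' \<noteq> e" "x $ e' \<notin> \<int>" by blast
  have "H e' \<subseteq> H e" using H_least[OF tight_H e'(1)] .
  then have "H e' = H e" using e_min[OF e'(3)] by (intro card_seteq) auto
  then have same: "e \<in> I \<longleftrightarrow> e' \<in> I" if "tight I" for I
    using H_least[OF that] H_self by blast
  \<comment> \<open>The slacks that limit the shift: nonnegativity at \<open>e\<close> and
    \<open>e'\<close>, and all rank bounds that are not tight. Tight sets contain both or neither of
    \<open>e\<close>, \<open>e'\<close>, so their sums do not change.\<close>
  define G where "G = insert (x $ e) (insert (x $ e') ((\<lambda>I. real (theta D I) - sum (vec_nth x) I) ` {I. \<not> tight I}))"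
  define \<epsilon> where "\<epsilon> = Min G"
  have G: "finite G" "G \<noteq> {}" by (simp_all add: G_def)
  have "0 < g" if "g \<in> G" for g
  proof -
    have "0 < x $ i" if "x $ i \<notin> \<int>" for i
      using x_nonneg[of i] that by (metis Ints_0 order_le_less)
    moreover have "0 < real (theta D I) - sum (vec_nth x) I" if "\<not> tight I" for I
      using x_le[of I] that by (simp add: tight_def)
    ultimately show ?thesis using that e e'(3) by (auto simp: G_def)
  qed
  then have \<epsilon>_pos: "0 < \<epsilon>" using G by (simp add: \<epsilon>_def)
  have \<epsilon>_le: "\<epsilon> \<le> g" if "g \<in> G" for g unfolding \<epsilon>_def using G that by simp
  have shift: "x + \<epsilon> *\<^sub>R (axis a 1 - axis b 1) \<in> schubitope D"
    if ab: "a \<noteq> b" "x $ b \<in> G" "\<And>I. tight I \<Longrightarrow> a \<in> I \<longleftrightarrow> b \<in> I" for a b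
  proof -
    let ?y = "x + \<epsilon> *\<^sub>R (axis a 1 - axis b 1)"
    have y: "?y $ i = x $ i + \<epsilon> * (of_bool (i = a) - of_bool (i = b))" for i
      by (simp add: axis_def)
    have sum_y: "sum (vec_nth ?y) I = sum (vec_nth x) I + \<epsilon> * (of_bool (a \<in> I) - of_bool (b \<in> I))" for I
      unfolding y by (simp add: sum.distrib sum_subtractf flip: sum_distrib_left)
    have "0 \<le> ?y $ i" for i
      unfolding y using x_nonneg[of i] \<epsilon>_le[OF ab(2)] \<epsilon>_pos ab(1) by auto
    moreover have "sum (vec_nth ?y) UNIV = real (num_boxes D)" unfolding sum_y using x_UNIV by simp
    moreover have "sum (vec_nth ?y) I \<le> real (theta D I)" for I
    proof (cases "tight I")
      case True
      then show ?thesis unfolding sum_y using ab(3)[OF True] x_le[of I] by simp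
    next
      case False
      then have "\<epsilon> \<le> real (theta D I) - sum (vec_nth x) I" by (intro \<epsilon>_le) (simp add: G_def)
      then show ?thesis unfolding sum_y using \<epsilon>_pos x_le[of I] by auto
    qed
    ultimately show ?thesis by (simp add: schubitope_def)
  qed
  define d :: "real ^ 'n::{finite,linorder}" where "d = \<epsilon> *\<^sub>R (axis e 1 - axis e' 1)"
  have "x + d \<in> schubitope D" unfolding d_def using e'(2) same by (intro shift) (auto simp: G_def)
  moreover have "x - d \<in> schubitope D"
  proof -
    have "x + \<epsilon> *\<^sub>R (axis e' 1 - axis e 1) \<in> schubitope D"
      using e'(2) same by (intro shift) (auto simp: G_def)
    then show ?thesis by (simp add: d_def algebra_simps)
  qed
  moreover have "x \<in> open_segment (x - d) (x + d)"
  proof -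
    have "d $ e = \<epsilon>" using e'(2) by (simp add: d_def axis_def)
    then have "d \<noteq> 0" using \<epsilon>_pos by auto
    then show ?thesis by (rule in_open_segment_minus_plus)
  qed
  ultimately show False using assms unfolding extreme_point_of_def by blast
qed

text \<open>If a lattice point lies on a segment between \<open>a\<close> and \<open>b\<close>, the
  same convex combination of decompositions of \<open>a\<close> and \<open>b\<close> decomposes it
  too. By uniqueness this agrees column by column with its decomposition into indicators of bases,
  so each column is constant along the segment.\<close>

lemma movable_disjoint_lattice_free:
  fixes D :: "'n::{finite,linorder} diagram"
  assumes "movable_disjoint D"
  shows "lattice_free (schubitope D)"
  unfolding lattice_free_def
proof (intro equalityI subsetI)
  fix x assume "x \<in> {x. x extreme_point_of (schubitope D)}"
  then show "x \<in> schubitope D \<inter> lattice_points"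
    using extreme_point_schubitope_in_lattice_points by (auto simp: extreme_point_of_def)
next
  fix x assume x: "x \<in> schubitope D \<inter> lattice_points"
  have "x \<in> (*\<^sub>R) (real 1) ` schubitope D" using x by simp
  then obtain T where T: "\<And>j k. k < 1 \<Longrightarrow> gale_le (T j k) (D j)"
    "x = (\<Sum>j\<in>UNIV. \<Sum>k<(1::nat). indicator_vec (T j k))"
    using scaled_schubitope_lattice_point_decomposition[of x 1 D] x by blast
  define w where "w j = (indicator_vec (T j 0) :: real ^ 'n::{finite,linorder})" for j
  have xw: "x = (\<Sum>j\<in>UNIV. w j)" unfolding T(2) w_def by simp
  have w: "vec_nth (w j) \<in> schubert_points 1 (D j)" for j
  proof -
    have "vec_nth (w j) = (\<lambda>i. of_bool (i \<in> T j 0))"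
      unfolding w_def by (intro ext indicator_vec_nth)
    then show ?thesis using of_bool_in_schubert_points[OF T(1), of 0 j] by simp
  qed
  have "x \<notin> open_segment a b" if a: "a \<in> schubitope D" and b: "b \<in> schubitope D" for a b
  proof
    assume "x \<in> open_segment a b"
    then obtain u where u: "a \<noteq> b" "0 < u" "u < 1" "x = (1 - u) *\<^sub>R a + u *\<^sub>R b"
      by (auto simp: in_segment)
    obtain f where f: "\<And>j. vec_nth (f j) \<in> schubert_points 1 (D j)" "a = (\<Sum>j\<in>UNIV. f j)"
      using schubitope_decomposition[OF a] by blast
    obtain g where g: "\<And>j. vec_nth (g j) \<in> schubert_points 1 (D j)" "b = (\<Sum>j\<in>UNIV. g j)"
      using schubitope_decomposition[OF b] by blast
    define h where "h j = (1 - u) *\<^sub>R f j + u *\<^sub>R g j" for j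
    have h: "vec_nth (h j) \<in> schubert_points 1 (D j)" for j
      using convex_schubert_points[of 1 "D j"] f(1) g(1) u(2,3) unfolding h_def convex_alt by auto
    have "(\<Sum>j\<in>UNIV. w j) = (\<Sum>j\<in>UNIV. h j)"
      unfolding xw[symmetric] u(4) f(2) g(2) h_def by (simp add: sum.distrib scaleR_sum_right)
    then have wh: "w = h" using movable_disjoint_unique[OF assms w h] by blast
    have "f j $ i = g j $ i" for i j
    proof -
      \<comment> \<open>A proper convex combination of two numbers between 0 and 1 is 0 or 1 only if
        the two numbers coincide.\<close>
      have *: "of_bool (i \<in> T j 0) = (1 - u) * f j $ i + u * g j $ i"
      proof -
        have "w j $ i = h j $ i" by (simp add: wh)
        then show ?thesis unfolding w_def indicator_vec_nth by (simp add: h_def)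
      qed
      have bounds: "0 \<le> f j $ i" "f j $ i \<le> 1" "0 \<le> g j $ i" "g j $ i \<le> 1"
        using schubert_points_nonneg[OF f(1)] schubert_points_nonneg[OF g(1)]
          schubert_points_le[OF f(1)] schubert_points_le[OF g(1)] by auto
      show ?thesis
      proof (cases "i \<in> T j 0")
        case True
        then have "(1 - u) * (1 - f j $ i) + u * (1 - g j $ i) = 0" using * by (simp add: algebra_simps)
        moreover have "0 \<le> (1 - u) * (1 - f j $ i)" "0 \<le> u * (1 - g j $ i)" using u bounds by auto
        ultimately have "(1 - u) * (1 - f j $ i) = 0 \<and> u * (1 - g j $ i) = 0" by linarith
        then show ?thesis using u by auto
      next
        case False
        then have "(1 - u) * f j $ i + u * g j $ i = 0" using * by simp
        moreover have "0 \<le> (1 - u) * f j $ i" "0 \<le> u * g j $ i" using u bounds by auto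
        ultimately have "(1 - u) * f j $ i = 0 \<and> u * g j $ i = 0" by linarith
        then show ?thesis using u by auto
      qed
    qed
    then have "f = g" by (simp add: fun_eq_iff vec_eq_iff)
    then show False using f(2) g(2) u(1) by simp
  qed
  then show "x \<in> {x. x extreme_point_of (schubitope D)}" using x by (simp add: extreme_point_of_def)
qed

theorem theorem1p1:
  fixes D :: "'n::{finite,linorder} diagram"
  shows "(lattice_free (schubitope D) \<longleftrightarrow>
            (\<forall>i j. i < j \<longrightarrow> card (movable_interval (D i) \<inter> movable_interval (D j)) \<le> 1))
       \<and> ((\<forall>i j. i < j \<longrightarrow> card (movable_interval (D i) \<inter> movable_interval (D j)) \<le> 1) \<longleftrightarrow>
            (\<forall>t. ehrhart (schubitope D) t =
                 (\<Prod>j\<in>UNIV. ehrhart (base_polytope (schubert_matroid_bases (D j))) t)))"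
  \<comment> \<open>If the condition on movable intervals fails, the product formula already fails
    at \<open>t = 1\<close>.\<close>
  using movable_disjoint_lattice_free[of D] not_movable_disjoint_not_lattice_free[of D]
    movable_disjoint_ehrhart[of D] not_movable_disjoint_ehrhart[of D] by blast

end
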